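(* Let $u(x,t)$ be a non-negative solution of the initial boundary value problem (P) described in the context. Let $U'$ be an open, relatively compact subset of $U$, and let $\alpha_0$ satisfy $\alpha_0\ge2-\delta$ and $\alpha_0>\alpha_*$. Let $\omega,\mu,\nu$ be as in the context. Then for $T>0$ and $0<\varepsilon<\min\{1,T\}$ one has $$\|u\|_{L^\infty(U'\times(\varepsilon,T))}\le C\varepsilon^{-2\omega}(1+T)^{3\omega}\max\Big\{\|u\|_{L^{\alpha_0}(U\times(0,T))}^{\mu},\ \|u\|_{L^{\alpha_0}(U\times(0,T))}^{\nu}\Big\}.$$ In particular, suppose in addition $\alpha_0>n\mu_0$. If $T>0$ satisfies $$\int_0^T\Big(1+\|\varphi^-(t)\|_{L^\infty(\Gamma)}^{\frac{2-a}{(1-a)(1-\theta_{\alpha_0})}}\Big)dt<\frac1{C_{3,\alpha_0}}\Big(1+\int_Uu_0^{\alpha_0}(x)dx\Big)^{-\mu_{1,\alpha_0}/\alpha_0},$$ then $$\|u\|_{L^\infty(U'\times(\varepsilon,T))}\le C\varepsilon^{-2\omega}(1+T)^{3\omega}\max\Big\{\Big(\int_0^T\mathcal U_{\alpha_0}(t)dt\Big)^{\mu/\alpha_0},\ \Big(\int_0^T\mathcal U_{\alpha_0}(t)dt\Big)^{\nu/\alpha_0}\Big\},$$ where $$\mathcal U_{\alpha_0}(t)=\Big\{\Big(1+\int_Uu_0^{\alpha_0}(x)dx\Big)^{-\frac{\mu_{1,\alpha_0}}{\alpha_0}}-C_{3,\alpha_0}\int_0^t\Big(1+\|\varphi^-(\tau)\|_{L^\infty(\Gamma)}^{\frac{2-a}{(1-a)(1-\theta_{\alpha_0})}}\Big)d\tau\Big\}^{-\frac{\alpha_0}{\mu_{1,\alpha_0}}}.$$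 Furthermore, if $T>0$ satisfies $$\int_0^T\Big(1+\|\varphi^-(t)\|_{L^\infty(\Gamma)}^{\frac{2-a}{(1-a)(1-\theta_{\alpha_0})}}\Big)dt\le\frac{1-2^{-\mu_{1,\alpha_0}/\alpha_0}}{C_{3,\alpha_0}}\Big(1+\int_Uu_0^{\alpha_0}(x)dx\Big)^{-\mu_{1,\alpha_0}/\alpha_0},$$ then $$\|u\|_{L^\infty(U'\times(\varepsilon,T))}\le C\varepsilon^{-2\omega}(1+T)^{3\omega+\nu/\alpha_0}\big(1+\|u_0\|_{L^{\alpha_0}(U)}\big)^{\nu}.$$ Above, the constant $C>0$ depends on $U$, $U'$ and $\alpha_0$ (and on $\lambda,g,n$).
   Context: Setting. $n\ge2$ is an integer; $U\subset\mathbb R^n$ is open and bounded with $C^1$ boundary $\Gamma=\partial U$ and outward normal $\vec\nu$. Fix an integer $N\ge1$, reals $0=\gamma_0<\gamma_1<\dots<\gamma_N$ and $a_0,\dots,a_N>0$, and set $g(s)=\sum_{i=0}^N a_is^{\gamma_i}$ for $s\ge0$. For $\xi\ge0$, $K(\xi)=1/g(s(\xi))$, where $s(\xi)$ is the unique non-negative solution $s$ of $s\,g(s)=\xi$. Put $a=\gamma_N/(\gamma_N+1)\in(0,1)$. Fix $\lambda\in(0,1]$ and set $\delta=1-\lambda$, $\alpha_*=n(a-\delta)/(2-a)$, $\mu_0=(a-\delta)/(1-a)$. Standing assumption: $a>\delta$. Problem (P): $\partial_t(u^\lambda)=\nabla\cdot(K(|\nabla u|)\nabla u)$ in $U\times(0,\infty)$;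 $u(x,0)=u_0(x)$ in $U$; $K(|\nabla u|)\frac{\partial u}{\partial\vec\nu}+\varphi u^\lambda=0$ on $\Gamma\times(0,\infty)$, where $u_0(x)$ and $\varphi(x,t)$ are given. Solutions are understood to be regular enough that the quantities involved make sense and that the equation may be multiplied by powers of $u$ (times smooth cut-offs) and integrated by parts. Notation: $f^-=\max\{-f,0\}$; $\|\varphi^-(t)\|_{L^\infty(\Gamma)}=\|\varphi^-(\cdot,t)\|_{L^\infty(\Gamma)}$. For $\alpha>n\mu_0$: $\theta_\alpha=\frac{1}{(1-a)(\alpha/\alpha_*-1)}\in(0,1)$, $\mu_{1,\alpha}=\frac{\mu_0(1+\theta_\alpha(1-a))}{1-\theta_\alpha}$. Constant $C_{3,\alpha}$ (for $\alpha\ge2-\delta$, $\alpha>n\mu_0$): $C_1,C_2>0$ are constants depending only on $\alpha,\lambda,g,n,U$ such that every non-negative solution of (P) satisfies $$\frac{d}{dt}\int_U u^\alpha dx+C_1\int_U|\nabla u|^{2-a}u^{\alpha+\delta-2}dx\le C_2\Big(1+\|\varphi^-(t)\|_{L^\infty(\Gamma)}^{\frac{2-a}{(1-a)(1-\theta_\alpha)}}\Big)\Big(1+\int_Uu^\alpha dx\Big)^{1+\mu_{1,\alpha}/\alpha},$$ and $C_{3,\alpha}=C_2\mu_{1,\alpha}/\alpha$. Numbers $\mu,\nu,\omega$: with $\kappa_*=1+\frac{2-a}n-\frac{a-\delta}{\alpha_0}$, $$\mu=\prod_{j=0}^\infty\frac{\alpha_0\kappa_*^j-2+\delta}{\alpha_0\kappa_*^j},\qquad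 \nu=\prod_{j=0}^\infty\frac{\alpha_0\kappa_*^j}{\alpha_0\kappa_*^j+\delta-a},$$ and $\omega>0$ is a number depending on $\alpha_0$ such that, for some constant $c_{10}\ge1$ depending only on $\lambda,g,n$, for every non-negative solution $u$ of (P), every ball $B_R$ ($R>0$) in a compact subset of $U$, every $T>0$ and $\sigma\in(0,1)$, $$\|u\|_{L^\infty(B_{R/2}\times(\sigma T,T))}\le\Big[2^{11}c_{10}\alpha_0^{6-a}(1+R^{-1})^2(1+|B_R|T)^3\Big(1+\frac1{\sigma T}+\frac1{R^{2-a}}\Big)^2\Big]^{\omega}\max\Big\{\|u\|^{\mu}_{L^{\alpha_0}(B_R\times(0,T))},\|u\|^{\nu}_{L^{\alpha_0}(B_R\times(0,T))}\Big\},$$ where $B_{R/2}$ is concentric with $B_R$. *)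

theory Defs
  imports "HOL-Analysis.Analysis" "HOL-Probability.Essential_Supremum"
begin

record forchheimer =
  top_index :: nat
  coeff_of :: "nat \<Rightarrow> real"
  power_of :: "nat \<Rightarrow> real"

definition forchheimer_law :: "forchheimer \<Rightarrow> bool" where
  "forchheimer_law G \<longleftrightarrow>
     1 \<le> top_index G \<and> power_of G 0 = 0 \<and>
     (\<forall>i < top_index G. power_of G i < power_of G (Suc i)) \<and>
     (\<forall>i \<le> top_index G. 0 < coeff_of G i)"

text \<open>The summand with exponent \<open>0\<close> is split off, because \<open>0 powr 0 = 0\<close> would
  otherwise give the value \<open>0\<close> instead of \<open>coeff_of G 0\<close> at \<open>s = 0\<close>.\<close>

definition g_fun :: "forchheimer \<Rightarrow> real \<Rightarrow> real" where
  "g_fun G s = coeff_of G 0 + (\<Sum>i=1..top_index G. coeff_of G i * s powr power_of G i)"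

definition K_fun :: "forchheimer \<Rightarrow> real \<Rightarrow> real" where
  "K_fun G \<xi> = 1 / g_fun G (THE s. 0 \<le> s \<and> s * g_fun G s = \<xi>)"

definition a_exp :: "forchheimer \<Rightarrow> real" where
  "a_exp G = power_of G (top_index G) / (power_of G (top_index G) + 1)"

definition alpha_star :: "nat \<Rightarrow> real \<Rightarrow> real \<Rightarrow> real" where
  "alpha_star n a \<delta> = real n * (a - \<delta>) / (2 - a)"

definition mu0 :: "real \<Rightarrow> real \<Rightarrow> real" where
  "mu0 a \<delta> = (a - \<delta>) / (1 - a)"

definition theta :: "nat \<Rightarrow> real \<Rightarrow> real \<Rightarrow> real \<Rightarrow> real" where
  "theta n a \<delta> \<alpha> = 1 / ((1 - a) * (\<alpha> / alpha_star n a \<delta> - 1))"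

definition mu1 :: "nat \<Rightarrow> real \<Rightarrow> real \<Rightarrow> real \<Rightarrow> real" where
  "mu1 n a \<delta> \<alpha> = mu0 a \<delta> * (1 + theta n a \<delta> \<alpha> * (1 - a)) / (1 - theta n a \<delta> \<alpha>)"

definition flux_power :: "nat \<Rightarrow> real \<Rightarrow> real \<Rightarrow> real \<Rightarrow> real" where
  "flux_power n a \<delta> \<alpha> = (2 - a) / ((1 - a) * (1 - theta n a \<delta> \<alpha>))"

definition kappa_star :: "nat \<Rightarrow> real \<Rightarrow> real \<Rightarrow> real \<Rightarrow> real" where
  "kappa_star n a \<delta> \<alpha>0 = 1 + (2 - a) / real n - (a - \<delta>) / \<alpha>0"

definition mu_exp :: "nat \<Rightarrow> real \<Rightarrow> real \<Rightarrow> real \<Rightarrow> real" where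
  "mu_exp n a \<delta> \<alpha>0 =
     (\<Prod>j. (\<alpha>0 * kappa_star n a \<delta> \<alpha>0 ^ j - 2 + \<delta>) / (\<alpha>0 * kappa_star n a \<delta> \<alpha>0 ^ j))"

definition nu_exp :: "nat \<Rightarrow> real \<Rightarrow> real \<Rightarrow> real \<Rightarrow> real" where
  "nu_exp n a \<delta> \<alpha>0 =
     (\<Prod>j. (\<alpha>0 * kappa_star n a \<delta> \<alpha>0 ^ j) / (\<alpha>0 * kappa_star n a \<delta> \<alpha>0 ^ j + \<delta> - a))"

definition Linf_norm :: "'a measure \<Rightarrow> ('a \<Rightarrow> real) \<Rightarrow> ennreal" where
  "Linf_norm M f = esssup M (\<lambda>x. ennreal \<bar>f x\<bar>)"

text \<open>A Bochner integral: a function that is not \<open>p\<close>-integrable gets the junk value \<open>0\<close>.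
  The norm is applied below only to functions that are continuous and bounded on a
  bounded open set.\<close>

definition Lp_norm :: "real \<Rightarrow> 'a::euclidean_space set \<Rightarrow> ('a \<Rightarrow> real) \<Rightarrow> real" where
  "Lp_norm p S f = (LINT x:S|lborel. \<bar>f x\<bar> powr p) powr (1 / p)"

definition ennreal_powr :: "ennreal \<Rightarrow> real \<Rightarrow> ennreal" where
  "ennreal_powr x p = (if x = \<infinity> then \<infinity> else ennreal (enn2real x powr p))"

definition hausdorff_outer :: "real \<Rightarrow> 'a::euclidean_space set \<Rightarrow> ennreal" where
  "hausdorff_outer s A =
     (SUP d\<in>{0<..}. INF C\<in>{C. A \<subseteq> (\<Union>i::nat. C i) \<and> (\<forall>i. bounded (C i) \<and> diameter (C i) \<le> d)}.
        \<Sum>i. ennreal (unit_ball_vol s * (diameter (C i) / 2) powr s))"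

text \<open>The surface measure of a \<open>C\<^sup>1\<close> hypersurface is the restriction of the
  \<open>(n - 1)\<close>-dimensional Hausdorff measure.\<close>

definition boundary_measure :: "(real^'n) set \<Rightarrow> (real^'n) measure" where
  "boundary_measure U =
     restrict_space (measure_of UNIV (sets borel) (hausdorff_outer (real CARD('n) - 1))) (frontier U)"

definition C1_on :: "'a::real_normed_vector set \<Rightarrow> ('a \<Rightarrow> 'b::real_normed_vector) \<Rightarrow> bool" where
  "C1_on S f \<longleftrightarrow> (\<exists>f' :: 'a \<Rightarrow> 'a \<Rightarrow>\<^sub>L 'b. continuous_on S f' \<and>
     (\<forall>x\<in>S. (f has_derivative blinfun_apply (f' x)) (at x)))"

text \<open>\<open>graph_fun e h\<close> is negative below and positive above the graph of \<open>h\<close>, where heights are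
  measured in the direction \<open>e\<close>; only the values of \<open>h\<close> on the orthogonal complement of
  \<open>e\<close> matter.\<close>

definition graph_fun :: "'a::euclidean_space \<Rightarrow> ('a \<Rightarrow> real) \<Rightarrow> 'a \<Rightarrow> real" where
  "graph_fun e h x = x \<bullet> e - h (x - (x \<bullet> e) *\<^sub>R e)"

definition graph_chart ::
    "'a::euclidean_space set \<Rightarrow> 'a \<Rightarrow> real \<Rightarrow> 'a \<Rightarrow> ('a \<Rightarrow> real) \<Rightarrow> bool" where
  "graph_chart U p r e h \<longleftrightarrow> 0 < r \<and> norm e = 1 \<and> C1_on UNIV h \<and>
     U \<inter> ball p r = {x \<in> ball p r. graph_fun e h x < 0}"

definition C1_domain :: "'a::euclidean_space set \<Rightarrow> bool" where
  "C1_domain U \<longleftrightarrow> open U \<and> bounded U \<and> (\<forall>p \<in> frontier U. \<exists>r e h. graph_chart U p r e h)"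

definition grad :: "('a::euclidean_space \<Rightarrow> real) \<Rightarrow> 'a \<Rightarrow> 'a" where
  "grad f x = (THE D. GDERIV f x :> D)"

definition outward_normal :: "'a::euclidean_space set \<Rightarrow> 'a \<Rightarrow> 'a \<Rightarrow> bool" where
  "outward_normal U p \<nu> \<longleftrightarrow>
     (\<exists>r e h. graph_chart U p r e h \<and> \<nu> = sgn (grad (graph_fun e h) p))"

definition divergence :: "(real^'n \<Rightarrow> real^'n) \<Rightarrow> real^'n \<Rightarrow> real" where
  "divergence F x = trace (jacobian F (at x))"

text \<open>Solutions are classical: \<open>u\<close> is continuous up to the boundary and up to time \<open>0\<close>; for
  positive times its spatial gradient \<open>Du\<close> and the time derivative \<open>w\<close> of \<open>u powr lam\<close> extend
  continuously to the closed domain (the boundary condition refers to this extension of the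
  gradient), and the flux is \<open>C\<^sup>1\<close> inside.  This makes all integrals below finite and
  allows testing with powers of \<open>u\<close> and integrating by parts.\<close>

definition nonneg_solution ::
    "forchheimer \<Rightarrow> real \<Rightarrow> (real^'n) set \<Rightarrow> (real^'n \<Rightarrow> real) \<Rightarrow> (real^'n \<Rightarrow> real \<Rightarrow> real) \<Rightarrow>
     (real^'n \<Rightarrow> real \<Rightarrow> real) \<Rightarrow> bool" where
  "nonneg_solution G lam U u0 \<phi> u \<longleftrightarrow>
     (\<lambda>(x, t). \<phi> x t) \<in> borel_measurable (restrict_space borel (frontier U \<times> {0<..})) \<and>
     (\<forall>x \<in> closure U. \<forall>t\<ge>0. 0 \<le> u x t) \<and>
     continuous_on (closure U \<times> {0..}) (\<lambda>(x, t). u x t) \<and>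
     (\<forall>x\<in>U. u x 0 = u0 x) \<and>
     (\<exists>Du w.
        continuous_on (closure U \<times> {0<..}) (\<lambda>(x, t). Du x t) \<and>
        continuous_on (closure U \<times> {0<..}) (\<lambda>(x, t). w x t) \<and>
        (\<forall>t>0. C1_on U (\<lambda>y. K_fun G (norm (Du y t)) *\<^sub>R Du y t)) \<and>
        (\<forall>t>0. \<forall>x\<in>U.
           GDERIV (\<lambda>y. u y t) x :> Du x t \<and>
           ((\<lambda>s. u x s powr lam) has_real_derivative w x t) (at t) \<and>
           w x t = divergence (\<lambda>y. K_fun G (norm (Du y t)) *\<^sub>R Du y t) x) \<and>
        (\<forall>t>0. \<forall>x \<in> frontier U. \<forall>\<nu>. outward_normal U x \<nu> \<longrightarrow>
           K_fun G (norm (Du x t)) * (Du x t \<bullet> \<nu>) + \<phi> x t * u x t powr lam = 0))"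

definition neg_part_norm :: "(real^'n) set \<Rightarrow> (real^'n \<Rightarrow> real \<Rightarrow> real) \<Rightarrow> real \<Rightarrow> ennreal" where
  "neg_part_norm U \<phi> t = Linf_norm (boundary_measure U) (\<lambda>x. max (- \<phi> x t) 0)"

text \<open>The inequality is stated in \<open>ennreal\<close> since the boundary norm may be infinite; truncating
  a negative left-hand side to \<open>0\<close> changes nothing, because the right-hand side is non-negative.
  Where \<open>u\<close> vanishes in \<open>U\<close>, so does its gradient, hence the value of \<open>0 powr 0\<close> is immaterial
  in the second integral.\<close>

definition energy_constants ::
    "forchheimer \<Rightarrow> real \<Rightarrow> (real^'n) set \<Rightarrow> real \<Rightarrow> real \<Rightarrow> real \<Rightarrow> bool" where
  "energy_constants G lam U \<alpha> C1 C2 \<longleftrightarrow>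
     (let n = CARD('n); a = a_exp G; \<delta> = 1 - lam in
      0 < C1 \<and> 0 < C2 \<and>
      (\<forall>u0 \<phi> u. nonneg_solution G lam U u0 \<phi> u \<longrightarrow>
        (\<forall>t>0. \<exists>D.
           ((\<lambda>s. LINT x:U|lborel. u x s powr \<alpha>) has_real_derivative D) (at t) \<and>
           ennreal (D + C1 * (LINT x:U|lborel.
              norm (grad (\<lambda>y. u y t) x) powr (2 - a) * u x t powr (\<alpha> + \<delta> - 2)))
           \<le> ennreal C2 * (1 + ennreal_powr (neg_part_norm U \<phi> t) (flux_power n a \<delta> \<alpha>)) *
             ennreal ((1 + (LINT x:U|lborel. u x t powr \<alpha>)) powr (1 + mu1 n a \<delta> \<alpha> / \<alpha>)))))"

definition C3_const :: "nat \<Rightarrow> real \<Rightarrow> real \<Rightarrow> real \<Rightarrow> real \<Rightarrow> real" where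
  "C3_const n a \<delta> \<alpha> C2 = C2 * mu1 n a \<delta> \<alpha> / \<alpha>"

text \<open>For \<open>\<alpha>0 = 2 - \<delta>\<close> the exponent \<open>mu_exp\<close> is \<open>0\<close>.  The value of \<open>0 powr 0\<close> plays no role,
  as the left-hand side vanishes along with the \<open>L\<close>-norm of \<open>u\<close>.\<close>

definition interior_estimate ::
    "forchheimer \<Rightarrow> real \<Rightarrow> (real^'n) set \<Rightarrow> real \<Rightarrow> real \<Rightarrow> real \<Rightarrow> bool" where
  "interior_estimate G lam U \<alpha>0 \<omega> c10 \<longleftrightarrow>
     (let n = CARD('n); a = a_exp G; \<delta> = 1 - lam in
      \<forall>u0 \<phi> u. nonneg_solution G lam U u0 \<phi> u \<longrightarrow>
        (\<forall>p R T \<sigma>. 0 < R \<and> (\<exists>S. compact S \<and> S \<subseteq> U \<and> ball p R \<subseteq> S) \<and>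
                   0 < T \<and> 0 < \<sigma> \<and> \<sigma> < 1 \<longrightarrow>
          Linf_norm (restrict_space lborel (ball p (R / 2) \<times> {\<sigma> * T<..<T})) (\<lambda>(x, t). u x t)
          \<le> ennreal
             ((2 ^ 11 * c10 * \<alpha>0 powr (6 - a) * (1 + 1 / R) ^ 2 *
               (1 + measure lborel (ball p R) * T) ^ 3 *
               (1 + 1 / (\<sigma> * T) + 1 / R powr (2 - a)) ^ 2) powr \<omega> *
              max (Lp_norm \<alpha>0 (ball p R \<times> {0<..<T}) (\<lambda>(x, t). u x t) powr mu_exp n a \<delta> \<alpha>0)
                  (Lp_norm \<alpha>0 (ball p R \<times> {0<..<T}) (\<lambda>(x, t). u x t) powr nu_exp n a \<delta> \<alpha>0))))"

definition flux_integral ::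
    "forchheimer \<Rightarrow> real \<Rightarrow> (real^'n) set \<Rightarrow> (real^'n \<Rightarrow> real \<Rightarrow> real) \<Rightarrow> real \<Rightarrow> real \<Rightarrow> ennreal" where
  "flux_integral G lam U \<phi> \<alpha> t =
     (\<integral>\<^sup>+ \<tau>\<in>{0..t}. (1 + ennreal_powr (neg_part_norm U \<phi> \<tau>)
        (flux_power (CARD('n)) (a_exp G) (1 - lam) \<alpha>)) \<partial>lborel)"

definition calU ::
    "forchheimer \<Rightarrow> real \<Rightarrow> (real^'n) set \<Rightarrow> (real^'n \<Rightarrow> real) \<Rightarrow> (real^'n \<Rightarrow> real \<Rightarrow> real) \<Rightarrow>
     real \<Rightarrow> real \<Rightarrow> real \<Rightarrow> real" where
  "calU G lam U u0 \<phi> \<alpha> C2 t =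
     (let n = CARD('n); a = a_exp G; \<delta> = 1 - lam in
      ((1 + (LINT x:U|lborel. u0 x powr \<alpha>)) powr (- (mu1 n a \<delta> \<alpha> / \<alpha>))
        - C3_const n a \<delta> \<alpha> C2 * enn2real (flux_integral G lam U \<phi> \<alpha> t))
      powr (- (\<alpha> / mu1 n a \<delta> \<alpha>)))"

end

theory Submission
  imports Defs
begin

text \<open>
  The proof combines the local estimate \<open>interior_estimate\<close>, which bounds the supremum of a solution
  on a small cylinder by its \<open>L\<close>-norm on a larger one, with the growth bound for the integral of
  \<open>u powr \<alpha>0\<close> that the energy inequality provides.

  A compact subset of \<open>U\<close> is covered by finitely many balls of a common radius, on each of which the
  local estimate holds with the same constant.  Enlarging the ball to \<open>U\<close> on the right-hand side
  is legitimate because both exponents \<open>mu_exp\<close> and \<open>nu_exp\<close> are non-negative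
  (\<open>sup_estimate_exponents\<close>), and this gives the first assertion (\<open>interior_sup_estimate\<close>).

  For the other two, let \<open>y(t)\<close> be the integral of \<open>u(\<cdot>, t) powr \<alpha>0\<close> over \<open>U\<close> and \<open>m = mu1 / \<alpha>0\<close>.  The
  energy inequality implies \<open>y' \<le> C2 h (1 + y) powr (1 + m)\<close>, where \<open>h\<close> is determined by the
  boundary data, so \<open>(1 + y) powr (- m)\<close> decreases at most at the rate \<open>C2 m h\<close>.  Integrating
  (\<open>superlinear_gronwall\<close>) gives \<open>1 + y \<le> calU\<close> as long as the accumulated \<open>h\<close> stays below the
  threshold (\<open>mass_le_calU\<close>), and by Fubini's theorem the \<open>L\<close>-norm on the cylinder is at most
  the power \<open>1 / \<alpha>0\<close> of the time integral of \<open>calU\<close>.  If the accumulated \<open>h\<close> stays below the fraction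
  \<open>1 - 2 powr (- m)\<close> of the threshold, then \<open>1 + y\<close> at most doubles (\<open>calU_le_double\<close>), and the last
  assertion follows since \<open>mu_exp \<le> 1 \<le> nu_exp\<close>.
\<close>

section \<open>The exponents\<close>

text \<open>The factor with index \<open>j\<close> differs from \<open>1\<close> by \<open>(c / b) q\<^sup>-\<^sup>j\<close>, so the product converges
  by comparison with a geometric series.\<close>

lemma geometric_ratio_prod_convergent:
  fixes b c q :: real
  assumes "0 < b" "1 < q"
  shows "convergent_prod (\<lambda>j. (b * q ^ j - c) / (b * q ^ j))"
proof (rule abs_convergent_prod_imp_convergent_prod)
  have "norm ((b * q ^ j - c) / (b * q ^ j) - 1) = \<bar>c / b\<bar> * (1 / q) ^ j" for j
  proof -
    have "(b * q ^ j - c) / (b * q ^ j) - 1 = - (c / b) * (1 / q) ^ j"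
      using assms by (simp add: field_simps)
    then show ?thesis
      using assms by (simp add: abs_mult)
  qed
  moreover have "summable (\<lambda>j. \<bar>c / b\<bar> * (1 / q) ^ j)"
    using assms by (intro summable_mult summable_geometric) auto
  ultimately show "abs_convergent_prod (\<lambda>j. (b * q ^ j - c) / (b * q ^ j))"
    unfolding abs_convergent_prod_conv_summable by simp
qed

lemma prodinf_unit_interval:
  fixes f :: "nat \<Rightarrow> real"
  assumes "convergent_prod f" "\<And>j. 0 \<le> f j" "\<And>j. f j \<le> 1"
  shows "0 \<le> prodinf f" "prodinf f \<le> 1"
proof -
  have lim: "(\<lambda>n. \<Prod>i\<le>n. f i) \<longlonglongrightarrow> prodinf f"
    by (rule convergent_prod_LIMSEQ[OF assms(1)])
  show "0 \<le> prodinf f"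
    using assms(2) by (intro LIMSEQ_le_const[OF lim]) (auto intro: prod_nonneg)
  show "prodinf f \<le> 1"
    using assms(2,3) by (intro LIMSEQ_le_const2[OF lim]) (auto intro: prod_le_1)
qed

lemma prodinf_ge_1:
  fixes f :: "nat \<Rightarrow> real"
  assumes "convergent_prod f" "\<And>j. 1 \<le> f j"
  shows "1 \<le> prodinf f"
  using assms(2) by (intro LIMSEQ_le_const[OF convergent_prod_LIMSEQ[OF assms(1)]]) (auto intro: prod_ge_1)

lemma top_power_pos:
  assumes "forchheimer_law G"
  shows "0 < power_of G (top_index G)"
proof -
  have "j \<le> top_index G \<Longrightarrow> 0 < j \<Longrightarrow> 0 < power_of G j" for j
  proof (induction j)
    case (Suc j)
    then show ?case
      using assms unfolding forchheimer_law_def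
      by (cases j) (fastforce dest: spec[of _ j] simp: Suc_le_eq)+
  qed simp
  then show ?thesis
    using assms unfolding forchheimer_law_def by simp
qed

lemma a_exp_less_1:
  assumes "forchheimer_law G"
  shows "a_exp G < 1"
  using top_power_pos[OF assms] by (simp add: a_exp_def)

text \<open>The condition \<open>alpha_star < \<alpha>0\<close> says precisely that each step of Moser's iteration gains
  integrability, that is, that the ratio of consecutive exponents exceeds \<open>1\<close>.\<close>

lemma kappa_star_gt_1:
  assumes "0 < n" "a < 1" "\<delta> < a" "alpha_star n a \<delta> < \<alpha>0"
  shows "0 < \<alpha>0" "1 < kappa_star n a \<delta> \<alpha>0"
proof -
  have "0 < alpha_star n a \<delta>"
    using assms by (simp add: alpha_star_def)
  with assms(4) show pos: "0 < \<alpha>0" by simp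
  have "real n * (a - \<delta>) < \<alpha>0 * (2 - a)"
    using assms by (simp add: alpha_star_def pos_divide_less_eq)
  then have "(a - \<delta>) / \<alpha>0 < (2 - a) / real n"
    using pos assms(1) by (simp add: field_simps)
  then show "1 < kappa_star n a \<delta> \<alpha>0"
    by (simp add: kappa_star_def)
qed

text \<open>Since \<open>kappa_star > 1\<close>, all the exponents \<open>\<alpha>0 kappa_star\<^sup>j\<close> are at least
  \<open>\<alpha>0 \<ge> 2 - \<delta>\<close>.  Hence the factors of the first product lie in \<open>[0, 1]\<close>, and those of the second,
  where \<open>\<delta> - a < 0\<close>, are at least \<open>1\<close>.\<close>

lemma sup_estimate_exponents:
  assumes "0 < n" "a < 1" "\<delta> < a" "2 - \<delta> \<le> \<alpha>0" "alpha_star n a \<delta> < \<alpha>0"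
  shows "0 \<le> mu_exp n a \<delta> \<alpha>0" "mu_exp n a \<delta> \<alpha>0 \<le> 1" "1 \<le> nu_exp n a \<delta> \<alpha>0"
proof -
  let ?q = "kappa_star n a \<delta> \<alpha>0"
  have pos: "0 < \<alpha>0" and q: "1 < ?q"
    using kappa_star_gt_1[OF assms(1,2,3,5)] by auto
  have ge: "2 - \<delta> \<le> \<alpha>0 * ?q ^ j" for j
    using mult_mono[OF assms(4), of 1 "?q ^ j"] pos q assms by (simp add: one_le_power)
  have xpos: "0 < \<alpha>0 * ?q ^ j" for j
    using ge[of j] assms by linarith
  note conv = geometric_ratio_prod_convergent[OF pos q]
  have mu: "mu_exp n a \<delta> \<alpha>0 = (\<Prod>j. (\<alpha>0 * ?q ^ j - (2 - \<delta>)) / (\<alpha>0 * ?q ^ j))"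
    by (simp add: mu_exp_def algebra_simps)
  have "0 \<le> (\<alpha>0 * ?q ^ j - (2 - \<delta>)) / (\<alpha>0 * ?q ^ j)"
    "(\<alpha>0 * ?q ^ j - (2 - \<delta>)) / (\<alpha>0 * ?q ^ j) \<le> 1" for j
    using ge[of j] xpos[of j] assms by (auto simp: divide_le_eq intro!: divide_nonneg_pos)
  then show "0 \<le> mu_exp n a \<delta> \<alpha>0" "mu_exp n a \<delta> \<alpha>0 \<le> 1"
    unfolding mu using prodinf_unit_interval[OF conv] by blast+
  have inv: "(\<alpha>0 * ?q ^ j) / (\<alpha>0 * ?q ^ j + \<delta> - a)
      = inverse ((\<alpha>0 * ?q ^ j - (a - \<delta>)) / (\<alpha>0 * ?q ^ j))" for j
    by (simp add: algebra_simps)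
  show "1 \<le> nu_exp n a \<delta> \<alpha>0"
    unfolding nu_exp_def
  proof (rule prodinf_ge_1)
    show "convergent_prod (\<lambda>j. (\<alpha>0 * ?q ^ j) / (\<alpha>0 * ?q ^ j + \<delta> - a))"
      unfolding inv by (rule convergent_prod_inverse[OF conv])
    show "1 \<le> (\<alpha>0 * ?q ^ j) / (\<alpha>0 * ?q ^ j + \<delta> - a)" for j
      using ge[of j] assms by (simp add: le_divide_eq)
  qed
qed

text \<open>The threshold \<open>n mu0\<close> is \<open>alpha_star (2 - a) / (1 - a)\<close>; above it \<open>theta\<close> lies strictly between
  \<open>0\<close> and \<open>1\<close>.\<close>

lemma mu1_pos:
  assumes "0 < n" "a < 1" "\<delta> < a" "real n * mu0 a \<delta> < \<alpha>"
  shows "0 < mu1 n a \<delta> \<alpha>"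
proof -
  have st: "0 < alpha_star n a \<delta>" and m0: "0 < mu0 a \<delta>"
    using assms by (auto simp: alpha_star_def mu0_def)
  have "real n * mu0 a \<delta> = alpha_star n a \<delta> * ((2 - a) / (1 - a))"
    using assms by (simp add: alpha_star_def mu0_def)
  with assms(4) have "(2 - a) / (1 - a) < \<alpha> / alpha_star n a \<delta>"
    using st by (simp add: less_divide_eq mult.commute)
  moreover have "(2 - a) / (1 - a) = 1 + 1 / (1 - a)"
    using assms by (simp add: field_simps)
  ultimately have "1 / (1 - a) < \<alpha> / alpha_star n a \<delta> - 1" by simp
  then have "1 < (1 - a) * (\<alpha> / alpha_star n a \<delta> - 1)"
    using assms by (simp add: pos_divide_less_eq mult.commute)
  then have "0 < theta n a \<delta> \<alpha>" "theta n a \<delta> \<alpha> < 1"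
    by (auto simp: theta_def)
  with m0 assms show ?thesis
    by (simp add: mu1_def add_pos_pos)
qed

section \<open>A superlinear Gronwall inequality\<close>

text \<open>One half of the fundamental theorem of calculus for a derivative that merely exists on the open
  interval and is bounded below by \<open>- h\<close>.  The gauge integral integrates every derivative, and it makes the
  negative part of \<open>D\<close> Lebesgue measurable; that part is a measurable function below \<open>h\<close>.  Since
  \<open>\<integral>\<^sup>+\<close> is a supremum over simple functions, it is monotone for arbitrary integrands, so the lemma
  applies to the boundary norms without an analysis of their measurability in time.\<close>

lemma drop_le_nn_integral:
  fixes Y D :: "real \<Rightarrow> real" and h :: "real \<Rightarrow> ennreal"
  assumes "0 \<le> t" "continuous_on {0..t} Y"
    and der: "\<And>s. 0 < s \<Longrightarrow> s < t \<Longrightarrow> (Y has_real_derivative D s) (at s)"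
    and le: "\<And>s. 0 < s \<Longrightarrow> s < t \<Longrightarrow> ennreal (- D s) \<le> h s"
  shows "ennreal (Y 0 - Y t) \<le> (\<integral>\<^sup>+ s\<in>{0..t}. h s \<partial>lborel)"
proof (cases "(\<integral>\<^sup>+ s\<in>{0..t}. h s \<partial>lborel) < \<infinity>")
  case True
  let ?p = "\<lambda>s. max (- D s * indicator {0<..<t} s) 0"
  have I: "((\<lambda>s. - D s) has_integral (Y 0 - Y t)) {0<..<t}"
    using has_integral_neg[OF fundamental_theorem_of_calculus_interior[of 0 t Y D]] assms
    by (simp add: has_integral_Icc_iff_Ioo has_real_derivative_iff_has_vector_derivative)
  have meas: "?p \<in> borel_measurable lebesgue"
    using has_integral_implies_lebesgue_measurable_real[OF I] by (intro borel_measurable_max) auto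
  have nn: "(\<integral>\<^sup>+ s. ennreal (?p s) \<partial>lebesgue) \<le> (\<integral>\<^sup>+ s\<in>{0..t}. h s \<partial>lborel)"
    unfolding nn_integral_completion using le
    by (intro nn_integral_mono) (auto simp: indicator_def max_def ennreal_neg dest: order_less_imp_le)
  have int: "integrable lebesgue ?p"
    using nn True meas by (intro integrableI_nonneg) (auto intro: le_less_trans)
  have "((\<lambda>s. - D s) has_integral (Y 0 - Y t)) {0<..<t} \<longleftrightarrow>
      ((\<lambda>s. - D s * indicator {0<..<t} s) has_integral (Y 0 - Y t)) UNIV"
    by (subst has_integral_restrict_UNIV[symmetric]) (auto simp: indicator_def intro!: has_integral_cong)
  with I have I': "((\<lambda>s. - D s * indicator {0<..<t} s) has_integral (Y 0 - Y t)) UNIV" by simp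
  have "Y 0 - Y t \<le> integral\<^sup>L lebesgue ?p"
    using has_integral_le[OF I' has_integral_integral_lebesgue[OF int]] by simp
  then have "ennreal (Y 0 - Y t) \<le> (\<integral>\<^sup>+ s. ennreal (?p s) \<partial>lebesgue)"
    by (subst nn_integral_eq_integral[OF int]) (auto intro: ennreal_leI)
  with nn show ?thesis by (rule order_trans[rotated])
next
  case False
  then have "(\<integral>\<^sup>+ s\<in>{0..t}. h s \<partial>lborel) = top" by (metis infinity_ennreal_def less_top)
  then show ?thesis by simp
qed

text \<open>Dividing the inequality \<open>y' \<le> c h (1 + y) powr (1 + m)\<close> by the power turns it into
  \<open>- (Y') \<le> h\<close> for \<open>Y = (1 + y) powr (- m) / (c * m)\<close>.  The bound lasts as long as the
  accumulated \<open>h\<close> has not used up the initial value of \<open>(1 + y) powr (- m)\<close>.\<close>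

lemma superlinear_gronwall:
  fixes y :: "real \<Rightarrow> real" and h :: "real \<Rightarrow> ennreal"
  assumes "0 \<le> t" "0 < m" "0 < c"
    and cont: "continuous_on {0..t} y" and nonneg: "\<And>s. 0 \<le> s \<Longrightarrow> s \<le> t \<Longrightarrow> 0 \<le> y s"
    and ineq: "\<And>s. 0 < s \<Longrightarrow> s < t \<Longrightarrow>
      \<exists>D. (y has_real_derivative D) (at s) \<and> ennreal D \<le> ennreal c * h s * ennreal ((1 + y s) powr (1 + m))"
    and fin: "(\<integral>\<^sup>+ s\<in>{0..t}. h s \<partial>lborel) = ennreal H" "0 \<le> H"
    and small: "c * m * H < (1 + y 0) powr (- m)"
  shows "1 + y t \<le> ((1 + y 0) powr (- m) - c * m * H) powr (- (1 / m))"
proof -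
  have pos: "0 < 1 + y s" if "0 \<le> s" "s \<le> t" for s
    using nonneg[OF that] by simp
  obtain E where E: "\<And>s. 0 < s \<Longrightarrow> s < t \<Longrightarrow> (y has_real_derivative E s) (at s)"
      "\<And>s. 0 < s \<Longrightarrow> s < t \<Longrightarrow> ennreal (E s) \<le> ennreal c * h s * ennreal ((1 + y s) powr (1 + m))"
    using ineq by metis
  \<comment> \<open>The normalisation makes \<open>- Y'\<close> comparable with \<open>h\<close> itself.\<close>
  define Y where "Y s = (1 + y s) powr (- m) / (c * m)" for s
  have "ennreal (Y 0 - Y t) \<le> ennreal H"
    unfolding fin(1)[symmetric]
  proof (rule drop_le_nn_integral)
    show "continuous_on {0..t} Y"
      unfolding Y_def using pos assms(2,3)
      by (intro continuous_intros cont) (auto simp: less_imp_neq[symmetric])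
    show "(Y has_real_derivative - ((1 + y s) powr (- (1 + m)) / c * E s)) (at s)" if s: "0 < s" "s < t" for s
    proof -
      have "((\<lambda>s. 1 + y s) has_real_derivative E s) (at s)"
        using E(1)[OF s] by (auto intro!: derivative_eq_intros)
      from DERIV_cdivide[OF DERIV_fun_powr[OF this, of "- m"], of "c * m"]
      have "(Y has_real_derivative - m * (1 + y s) powr (- m - of_nat 1) * E s / (c * m)) (at s)"
        using pos[of s] s unfolding Y_def by simp
      moreover have "- m - of_nat 1 = - (1 + m)" by simp
      ultimately have "(Y has_real_derivative - m * (1 + y s) powr (- (1 + m)) * E s / (c * m)) (at s)"
        by metis
      moreover have "- m * (1 + y s) powr (- (1 + m)) * E s / (c * m)
          = - ((1 + y s) powr (- (1 + m)) / c * E s)"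
        using assms(2,3) by (simp add: field_simps del: minus_add_distrib)
      ultimately show ?thesis by metis
    qed
    show "ennreal (- (- ((1 + y s) powr (- (1 + m)) / c * E s))) \<le> h s" if s: "0 < s" "s < t" for s
    proof -
      let ?P = "(1 + y s) powr (1 + m)"
      have P: "0 < ?P" using pos[of s] s by simp
      have inv: "(1 + y s) powr (- (1 + m)) = 1 / ?P" by (rule powr_minus_divide)
      have "ennreal ((1 + y s) powr (- (1 + m)) / c * E s) = ennreal (1 / (c * ?P)) * ennreal (E s)"
        unfolding inv using assms(3) P by (subst ennreal_mult'[symmetric]) (auto simp: mult.commute)
      also have "\<dots> \<le> ennreal (1 / (c * ?P)) * (ennreal c * h s * ennreal ?P)"
        by (rule mult_left_mono[OF E(2)[OF s]]) simp
      also have "\<dots> = (ennreal (1 / (c * ?P)) * ennreal c * ennreal ?P) * h s"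
        by (simp add: ac_simps)
      also have "ennreal (1 / (c * ?P)) * ennreal c * ennreal ?P = 1"
        using assms(3) P by (simp add: ennreal_mult'[symmetric])
      finally show ?thesis by simp
    qed
  qed (use assms in auto)
  then have "Y 0 - Y t \<le> H" using fin(2) by (simp add: ennreal_le_iff)
  then have le: "(1 + y 0) powr (- m) - c * m * H \<le> (1 + y t) powr (- m)"
    using assms(2,3) unfolding Y_def by (simp add: field_simps)
  have "1 + y t = ((1 + y t) powr (- m)) powr (- (1 / m))"
    using pos[of t] assms(1,2) by (simp add: powr_powr)
  also have "\<dots> \<le> ((1 + y 0) powr (- m) - c * m * H) powr (- (1 / m))"
    using le small assms(2) by (intro powr_mono2') auto
  finally show ?thesis .
qed

section \<open>Integrals over cylinders\<close>

lemma continuous_set_integrable_bounded: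
  fixes f :: "'a::euclidean_space \<Rightarrow> real"
  assumes "S \<in> sets borel" "S \<subseteq> C" "compact C" "continuous_on C f"
  shows "set_integrable lborel S f"
proof (rule set_integrable_subset[of lborel C])
  show "set_integrable lborel C f"
    unfolding set_integrable_def by (rule borel_integrable_compact[OF assms(3,4)])
qed (use assms in auto)

lemma continuous_on_slice:
  assumes "continuous_on (A \<times> B) (\<lambda>(x, t). f x t)" "t \<in> B"
  shows "continuous_on A (\<lambda>x. f x t)"
proof -
  have "continuous_on A (\<lambda>x. (x, t))" by (intro continuous_intros)
  from continuous_on_compose2[OF assms(1) this] show ?thesis using assms(2) by auto
qed

text \<open>Dominated convergence, the dominating function being a constant on the bounded set \<open>U\<close>.\<close>

lemma continuous_on_slice_integral:
  fixes f :: "'a::euclidean_space \<Rightarrow> real \<Rightarrow> real"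
  assumes "open U" "bounded U" and f: "continuous_on (closure U \<times> {0..T}) (\<lambda>(x, t). f x t)"
  shows "continuous_on {0..T} (\<lambda>t. LINT x:U|lborel. f x t)"
  unfolding continuous_on_sequentially comp_def set_lebesgue_integral_def
proof (intro allI ballI impI, elim conjE)
  have comp: "compact (closure U)" using assms(2) by (rule compact_closure[THEN iffD2])
  have "compact ((\<lambda>(x, t). f x t) ` (closure U \<times> {0..T}))"
    by (intro compact_continuous_image f compact_Times comp) auto
  then obtain B where B: "\<And>x t. x \<in> closure U \<Longrightarrow> t \<in> {0..T} \<Longrightarrow> \<bar>f x t\<bar> \<le> B"
    by (force dest!: compact_imp_bounded simp: bounded_iff)
  have slice: "integrable lborel (\<lambda>x. indicator U x *\<^sub>R f x t)" if "t \<in> {0..T}" for t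
    using continuous_set_integrable_bounded[of U "closure U", OF _ closure_subset comp
        continuous_on_slice[OF f that]] assms(1)
    by (simp add: set_integrable_def)
  fix X t assume X: "t \<in> {0..T}" "\<forall>n. X n \<in> {0..T}" "X \<longlonglongrightarrow> t"
  show "(\<lambda>n. LINT x|lborel. indicator U x *\<^sub>R f x (X n)) \<longlonglongrightarrow> (LINT x|lborel. indicator U x *\<^sub>R f x t)"
  proof (rule integral_dominated_convergence[where w = "\<lambda>x. indicator U x * B"])
    show "integrable lborel (\<lambda>x. indicator U x * B)"
      using emeasure_bounded_finite[OF assms(2)] assms(1)
      by (intro integrable_mult_left integrable_real_indicator) auto
    show "AE x in lborel. (\<lambda>n. indicator U x *\<^sub>R f x (X n)) \<longlonglongrightarrow> indicator U x *\<^sub>R f x t"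
    proof (rule AE_I2)
      fix x
      have "(\<lambda>n. f x (X n)) \<longlonglongrightarrow> f x t" if "x \<in> U"
      proof -
        have "(\<lambda>n. (x, X n)) \<longlonglongrightarrow> (x, t)" by (intro tendsto_intros X)
        moreover have "(x, t) \<in> closure U \<times> {0..T}" "\<forall>n. (x, X n) \<in> closure U \<times> {0..T}"
          using that X closure_subset by auto
        ultimately have "(\<lambda>n. case (x, X n) of (x, t) \<Rightarrow> f x t) \<longlonglongrightarrow> (case (x, t) of (x, t) \<Rightarrow> f x t)"
          using f[unfolded continuous_on_sequentially comp_def, rule_format, of "(x, t)" "\<lambda>n. (x, X n)"] by blast
        then show ?thesis by simp
      qed
      then show "(\<lambda>n. indicator U x *\<^sub>R f x (X n)) \<longlonglongrightarrow> indicator U x *\<^sub>R f x t"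
        by (cases "x \<in> U") simp_all
    qed
    show "AE x in lborel. norm (indicator U x *\<^sub>R f x (X n)) \<le> indicator U x * B" for n
    proof (rule AE_I2)
      show "norm (indicator U x *\<^sub>R f x (X n)) \<le> indicator U x * B" for x
        using B[of x "X n"] X(2) closure_subset[of U] by (cases "x \<in> U") auto
    qed
    show "(\<lambda>x. indicator U x *\<^sub>R f x (X n)) \<in> borel_measurable lborel" for n
      using slice X(2) by (intro borel_measurable_integrable) blast
    show "(\<lambda>x. indicator U x *\<^sub>R f x t) \<in> borel_measurable lborel"
      using slice X(1) by (intro borel_measurable_integrable) blast
  qed
qed

text \<open>Fubini's theorem; passing from the open to the closed time interval only adds a null set.\<close>

lemma cylinder_integral:
  fixes f :: "'a::euclidean_space \<Rightarrow> real \<Rightarrow> real"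
  assumes "open U" "bounded U" and f: "continuous_on (closure U \<times> {0..T}) (\<lambda>(x, t). f x t)"
  shows "(LINT z:U \<times> {0<..<T}|lborel. case z of (x, t) \<Rightarrow> f x t)
    = (LINT t:{0..T}|lborel. LINT x:U|lborel. f x t)"
proof -
  let ?g = "\<lambda>x t. indicator U x * (indicator {0<..<T} t * f x t)"
  have comp: "compact (closure U \<times> {0..T})" using assms(2) by (intro compact_Times) auto
  have "set_integrable lborel (U \<times> {0<..<T}) (\<lambda>(x, t). f x t)"
    using assms(1) closure_subset
    by (intro continuous_set_integrable_bounded[OF _ _ comp f]) (auto intro!: borel_open open_Times)
  moreover have eq: "indicator (U \<times> {0<..<T}) z *\<^sub>R (case z of (x, t) \<Rightarrow> f x t) = case_prod ?g z" for z
    by (cases z) (auto simp: indicator_def)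
  ultimately have int: "integrable (lborel \<Otimes>\<^sub>M lborel) (case_prod ?g)"
    unfolding set_integrable_def eq lborel_prod by simp
  have "(LINT z:U \<times> {0<..<T}|lborel. case z of (x, t) \<Rightarrow> f x t) = (LINT t|lborel. LINT x|lborel. ?g x t)"
    unfolding set_lebesgue_integral_def eq using lborel_pair.integral_snd[OF int] by (simp add: lborel_prod)
  also have "\<dots> = (LINT t:{0<..<T}|lborel. LINT x:U|lborel. f x t)"
    unfolding set_lebesgue_integral_def by (simp add: mult.left_commute[of "indicator U _"])
  also have "\<dots> = (LINT t:{0..T}|lborel. LINT x:U|lborel. f x t)"
    by (rule set_integral_discrete_difference[where X = "{0, T}"]) auto
  finally show ?thesis .
qed

section \<open>Essential suprema and power norms\<close>

lemma Linf_norm_leI: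
  assumes "f \<in> borel_measurable M" "AE x in M. ennreal \<bar>f x\<bar> \<le> c"
  shows "Linf_norm M f \<le> c"
  unfolding Linf_norm_def using assms by (intro esssup_I) auto

lemma AE_le_Linf_norm: "AE x in M. ennreal \<bar>f x\<bar> \<le> Linf_norm M f"
  unfolding Linf_norm_def by (rule esssup_AE)

lemma measurable_cylinder:
  fixes f :: "'a::euclidean_space \<Rightarrow> real \<Rightarrow> real"
  assumes "continuous_on S (\<lambda>(x, t). f x t)" "W \<subseteq> S"
  shows "(\<lambda>(x, t). f x t) \<in> borel_measurable (restrict_space lborel W)"
proof -
  have "sets (restrict_space lborel W) = sets (restrict_space borel W)"
    by (rule sets_restrict_space_cong) simp
  then show ?thesis
    using borel_measurable_continuous_on_restrict[OF continuous_on_subset[OF assms]]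
    by (subst measurable_cong_sets[OF _ refl])
qed

lemma Lp_norm_mono:
  fixes f :: "'a::euclidean_space \<Rightarrow> real"
  assumes "set_integrable lborel B (\<lambda>x. \<bar>f x\<bar> powr p)" "A \<in> sets borel" "A \<subseteq> B" "0 \<le> p"
  shows "Lp_norm p A f \<le> Lp_norm p B f"
proof -
  have A: "set_integrable lborel A (\<lambda>x. \<bar>f x\<bar> powr p)"
    using set_integrable_subset[OF assms(1)] assms by auto
  have "(LINT x:A|lborel. \<bar>f x\<bar> powr p) \<le> (LINT x:B|lborel. \<bar>f x\<bar> powr p)"
    using A assms unfolding set_integrable_def set_lebesgue_integral_def
    by (intro integral_mono) (auto simp: indicator_def)
  moreover have "0 \<le> (LINT x:A|lborel. \<bar>f x\<bar> powr p)"
    unfolding set_lebesgue_integral_def by (intro integral_nonneg_AE) (auto simp: indicator_def)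
  ultimately show ?thesis
    unfolding Lp_norm_def using assms(4) by (intro powr_mono2) auto
qed

section \<open>The interior estimate on a compact subset\<close>

text \<open>The powers of \<open>\<epsilon>\<close> and \<open>1 + T\<close> in the estimate come out of the constant of the local estimate
  by \<open>1 + b T \<le> (1 + b) (1 + T)\<close> and \<open>1 + 1 / \<epsilon> + d \<le> (2 + d) / \<epsilon>\<close>.\<close>

lemma interior_constant_le:
  fixes A b d T \<epsilon> \<omega> :: real
  assumes "0 \<le> A" "0 \<le> b" "0 \<le> d" "0 < T" "0 < \<epsilon>" "\<epsilon> < 1" "0 \<le> \<omega>"
  shows "(A * (1 + b * T) ^ 3 * (1 + 1 / \<epsilon> + d) ^ 2) powr \<omega>
    \<le> (A * (1 + b) ^ 3 * (2 + d) ^ 2) powr \<omega> * \<epsilon> powr (- 2 * \<omega>) * (1 + T) powr (3 * \<omega>)"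
proof -
  have "1 + b * T \<le> (1 + b) * (1 + T)" using assms by (simp add: algebra_simps)
  then have 1: "(1 + b * T) ^ 3 \<le> ((1 + b) * (1 + T)) ^ 3" using assms by (intro power_mono) auto
  have "1 \<le> 1 / \<epsilon>" using assms by simp
  with mult_left_mono[OF this assms(3)] have "1 + 1 / \<epsilon> + d \<le> (2 + d) * (1 / \<epsilon>)"
    by (simp add: algebra_simps)
  then have 2: "(1 + 1 / \<epsilon> + d) ^ 2 \<le> ((2 + d) * (1 / \<epsilon>)) ^ 2" using assms by (intro power_mono) auto
  have "(A * (1 + b * T) ^ 3 * (1 + 1 / \<epsilon> + d) ^ 2) powr \<omega>
      \<le> (A * ((1 + b) * (1 + T)) ^ 3 * ((2 + d) * (1 / \<epsilon>)) ^ 2) powr \<omega>"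
    using assms 1 2 by (intro powr_mono2 mult_mono) auto
  also have "\<dots> = ((A * (1 + b) ^ 3 * (2 + d) ^ 2) * (1 / \<epsilon>) ^ 2 * (1 + T) ^ 3) powr \<omega>"
    unfolding power_mult_distrib by (simp only: ac_simps)
  also have "\<dots> = (A * (1 + b) ^ 3 * (2 + d) ^ 2) powr \<omega> * ((1 / \<epsilon>) ^ 2) powr \<omega> * ((1 + T) ^ 3) powr \<omega>"
    using assms by (simp add: powr_mult)
  also have "(1 / \<epsilon>) ^ 2 = \<epsilon> powr (- 2)"
    using assms by (simp add: powr_minus power_one_over divide_inverse power_inverse)
  also have "(1 + T) ^ 3 = (1 + T) powr 3"
    using assms by simp
  also have "(\<epsilon> powr (- 2)) powr \<omega> = \<epsilon> powr (- 2 * \<omega>)"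
    by (rule powr_powr)
  also have "((1 + T) powr 3) powr \<omega> = (1 + T) powr (3 * \<omega>)"
    by (rule powr_powr)
  finally show ?thesis .
qed

lemma compact_cball_margin:
  fixes K :: "'a::euclidean_space set"
  assumes "compact K" "open U" "K \<subseteq> U"
  obtains R where "0 < R" "\<And>p. p \<in> K \<Longrightarrow> cball p R \<subseteq> U"
proof -
  obtain e where "0 < e" and e: "(\<Union>x\<in>K. cball x e) \<subseteq> U"
    using compact_subset_open_imp_cball_epsilon_subset[OF assms] by blast
  then show thesis by (intro that[of e]) auto
qed

lemma solution_powr_continuous:
  assumes "nonneg_solution G lam U u0 \<phi> u" "0 < p"
  shows "continuous_on (closure U \<times> {0..T}) (\<lambda>(x, t). u x t powr p)"
proof -
  have "continuous_on (closure U \<times> {0..T}) (\<lambda>(x, t). u x t)"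
    using assms(1) unfolding nonneg_solution_def by (auto elim: continuous_on_subset)
  moreover have "\<forall>x\<in>closure U. \<forall>t\<ge>0. 0 \<le> u x t"
    using assms(1) unfolding nonneg_solution_def by blast
  ultimately have "continuous_on (closure U \<times> {0..T}) (\<lambda>z. (case z of (x, t) \<Rightarrow> u x t) powr p)"
    using assms(2) by (intro continuous_on_powr') (auto intro!: continuous_intros)
  then show ?thesis by (simp add: case_prod_beta)
qed

lemma solution_nonneg:
  assumes "nonneg_solution G lam U u0 \<phi> u" "x \<in> U" "0 \<le> t"
  shows "0 \<le> u x t"
  using assms closure_subset unfolding nonneg_solution_def by blast

lemma solution_initial:
  assumes "nonneg_solution G lam U u0 \<phi> u" "x \<in> U"
  shows "u x 0 = u0 x"
  using assms unfolding nonneg_solution_def by blast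

lemma Lp_norm_cylinder:
  fixes U :: "(real^'n) set"
  assumes sol: "nonneg_solution G lam U u0 \<phi> u" and "open U" "bounded U" "0 < p"
  shows "Lp_norm p (U \<times> {0<..<T}) (\<lambda>(x, t). u x t)
    = (LINT t:{0..T}|lborel. LINT x:U|lborel. u x t powr p) powr (1 / p)"
proof -
  have "(LINT z:U \<times> {0<..<T}|lborel. \<bar>case z of (x, t) \<Rightarrow> u x t\<bar> powr p)
      = (LINT z:U \<times> {0<..<T}|lborel. case z of (x, t) \<Rightarrow> u x t powr p)"
    using solution_nonneg[OF sol] assms(2)
    by (intro set_lebesgue_integral_cong) (auto intro!: borel_open open_Times)
  also have "\<dots> = (LINT t:{0..T}|lborel. LINT x:U|lborel. u x t powr p)"
    by (rule cylinder_integral[OF assms(2,3) solution_powr_continuous[OF sol assms(4)]])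
  finally show ?thesis by (simp add: Lp_norm_def)
qed

text \<open>The Bochner integral is monotone in the domain because \<open>u\<close> is continuous up to the boundary, hence
  \<open>p\<close>-integrable on the large cylinder.\<close>

lemma Lp_norm_ball_le_cylinder:
  fixes U :: "(real^'n) set"
  assumes sol: "nonneg_solution G lam U u0 \<phi> u" and "open U" "bounded U" "0 < p"
    and "ball c R \<subseteq> U"
  shows "Lp_norm p (ball c R \<times> {0<..<T}) (\<lambda>(x, t). u x t) \<le> Lp_norm p (U \<times> {0<..<T}) (\<lambda>(x, t). u x t)"
proof (rule Lp_norm_mono)
  have "set_integrable lborel (U \<times> {0<..<T}) (\<lambda>(x, t). u x t powr p)"
    using assms(2,3) closure_subset
    by (intro continuous_set_integrable_bounded[OF _ _ _ solution_powr_continuous[OF sol assms(4), of T]])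
       (auto intro!: borel_open open_Times compact_Times)
  moreover have "set_integrable lborel (U \<times> {0<..<T}) (\<lambda>(x, t). u x t powr p)
      \<longleftrightarrow> set_integrable lborel (U \<times> {0<..<T}) (\<lambda>z. \<bar>case z of (x, t) \<Rightarrow> u x t\<bar> powr p)"
    using solution_nonneg[OF sol] by (intro set_integrable_cong) auto
  ultimately show "set_integrable lborel (U \<times> {0<..<T}) (\<lambda>z. \<bar>case z of (x, t) \<Rightarrow> u x t\<bar> powr p)"
    by blast
qed (use assms in \<open>auto intro!: borel_open open_Times\<close>)

lemma max_powr_mono:
  fixes x y :: real
  assumes "0 \<le> x" "x \<le> y" "0 \<le> \<mu>" "0 \<le> \<nu>"
  shows "max (x powr \<mu>) (x powr \<nu>) \<le> max (y powr \<mu>) (y powr \<nu>)"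
  using assms by (intro max.mono powr_mono2) auto

text \<open>By compactness there is one radius \<open>R\<close> for which all balls centred in \<open>closure U'\<close> stay inside
  \<open>U\<close>, and finitely many of the half-sized balls cover \<open>U'\<close>.  With a common radius, and since the
  volume of a ball is independent of its centre, the local estimate has the same constant on all of
  them.  Choosing \<open>\<sigma> = \<epsilon> / T\<close> makes its time interval start at \<open>\<epsilon>\<close>.\<close>

lemma interior_sup_estimate:
  fixes U U' :: "(real^'n) set"
  assumes est: "interior_estimate G lam U p \<omega> c10" and "1 \<le> c10"
    and U: "open U" "bounded U" and U': "open U'" "compact (closure U')" "closure U' \<subseteq> U"
    and "0 < p" "0 \<le> \<omega>"
    and "0 \<le> mu_exp CARD('n) (a_exp G) (1 - lam) p" (is "0 \<le> ?\<mu>")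
    and "0 \<le> nu_exp CARD('n) (a_exp G) (1 - lam) p" (is "0 \<le> ?\<nu>")
  obtains C where "0 < C"
    "\<And>u0 \<phi> u T \<epsilon>. nonneg_solution G lam U u0 \<phi> u \<Longrightarrow> 0 < T \<Longrightarrow> 0 < \<epsilon> \<Longrightarrow> \<epsilon> < min 1 T \<Longrightarrow>
      Linf_norm (restrict_space lborel (U' \<times> {\<epsilon><..<T})) (\<lambda>(x, t). u x t)
      \<le> ennreal (C * \<epsilon> powr (- 2 * \<omega>) * (1 + T) powr (3 * \<omega>) *
          max (Lp_norm p (U \<times> {0<..<T}) (\<lambda>(x, t). u x t) powr ?\<mu>)
              (Lp_norm p (U \<times> {0<..<T}) (\<lambda>(x, t). u x t) powr ?\<nu>))"
proof -
  obtain R where R: "0 < R" "\<And>q. q \<in> closure U' \<Longrightarrow> cball q R \<subseteq> U"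
    using compact_cball_margin[OF U'(2) U(1) U'(3)] by blast
  obtain F where F: "F \<subseteq> closure U'" "finite F" "closure U' \<subseteq> (\<Union>q\<in>F. ball q (R / 2))"
  proof (rule compactE_image[OF U'(2)])
    show "open (ball q (R / 2))" if "q \<in> closure U'" for q :: "real^'n" by simp
    show "closure U' \<subseteq> (\<Union>q\<in>closure U'. ball q (R / 2))" using R(1) by force
  qed blast
  define A where "A = 2 ^ 11 * c10 * p powr (6 - a_exp G) * (1 + 1 / R) ^ 2"
  define b where "b = measure lborel (ball (0 :: real^'n) R)"
  define d where "d = 1 / R powr (2 - a_exp G)"
  define C where "C = (A * (1 + b) ^ 3 * (2 + d) ^ 2) powr \<omega>"
  have "0 < 1 + 1 / R" using R(1) by (simp add: add_pos_pos)
  then have A: "0 < A" unfolding A_def using assms(2,8) by (intro mult_pos_pos zero_less_power) auto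
  have b: "0 \<le> b" and d: "0 \<le> d" by (simp_all add: b_def d_def)
  have ball_measure: "measure lborel (ball q R) = b" for q :: "real^'n"
    using content_ball_conv_unit_ball[of R q] content_ball_conv_unit_ball[of R "0 :: real^'n"] R(1)
    by (simp add: b_def)
  show thesis
  proof (rule that)
    show "0 < C"
      unfolding C_def using A b d by (intro powr_gt_zero[THEN iffD2] mult_pos_pos less_imp_neq[symmetric]) auto
    fix u0 \<phi> u and T \<epsilon> :: real
    assume sol: "nonneg_solution G lam U u0 \<phi> u" and T: "0 < T" and \<epsilon>: "0 < \<epsilon>" "\<epsilon> < min 1 T"
    let ?L = "\<lambda>V. Lp_norm p (V \<times> {0<..<T}) (\<lambda>(x, t). u x t)"
    let ?M = "\<lambda>V. max (?L V powr ?\<mu>) (?L V powr ?\<nu>)"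
    let ?B = "C * \<epsilon> powr (- 2 * \<omega>) * (1 + T) powr (3 * \<omega>) * ?M U"
    have near: "AE z in lborel. z \<in> ball q (R / 2) \<times> {\<epsilon><..<T} \<longrightarrow> ennreal \<bar>case z of (x, t) \<Rightarrow> u x t\<bar> \<le> ennreal ?B"
      if "q \<in> F" for q
    proof -
      have cb: "cball q R \<subseteq> U" using R(2) F(1) that by blast
      then have adm: "0 < R \<and> (\<exists>S. compact S \<and> S \<subseteq> U \<and> ball q R \<subseteq> S) \<and> 0 < T \<and> 0 < \<epsilon> / T \<and> \<epsilon> / T < 1"
        using R(1) T \<epsilon> by (intro conjI exI[of _ "cball q R"]) auto
      have "\<epsilon> / T * T = \<epsilon>" using T by simp
      then have "Linf_norm (restrict_space lborel (ball q (R / 2) \<times> {\<epsilon><..<T})) (\<lambda>(x, t). u x t)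
          \<le> ennreal ((A * (1 + b * T) ^ 3 * (1 + 1 / \<epsilon> + d) ^ 2) powr \<omega> * ?M (ball q R))"
        using est[unfolded interior_estimate_def Let_def, rule_format, OF sol adm]
        by (simp only: A_def d_def ball_measure)
      also have "\<dots> \<le> ennreal ?B"
      proof (intro ennreal_leI mult_mono)
        show "(A * (1 + b * T) ^ 3 * (1 + 1 / \<epsilon> + d) ^ 2) powr \<omega> \<le> C * \<epsilon> powr (- 2 * \<omega>) * (1 + T) powr (3 * \<omega>)"
          unfolding C_def using A b d T \<epsilon> assms by (intro interior_constant_le) auto
        have "?L (ball q R) \<le> ?L U"
          using cb ball_subset_cball[of q R] assms by (intro Lp_norm_ball_le_cylinder[OF sol U]) auto
        then show "?M (ball q R) \<le> ?M U"
          using assms by (intro max_powr_mono) (auto simp: Lp_norm_def)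
      qed (auto simp: C_def le_max_iff_disj)
      finally have "Linf_norm (restrict_space lborel (ball q (R / 2) \<times> {\<epsilon><..<T})) (\<lambda>(x, t). u x t) \<le> ennreal ?B" .
      then have "AE z in restrict_space lborel (ball q (R / 2) \<times> {\<epsilon><..<T}).
          ennreal \<bar>case z of (x, t) \<Rightarrow> u x t\<bar> \<le> ennreal ?B"
        by (intro eventually_mono[OF AE_le_Linf_norm[where f = "\<lambda>(x, t). u x t"]]) (rule order_trans)
      then show ?thesis
        by (subst (asm) AE_restrict_space_iff) (auto intro!: borel_open open_Times)
    qed
    show "Linf_norm (restrict_space lborel (U' \<times> {\<epsilon><..<T})) (\<lambda>(x, t). u x t) \<le> ennreal ?B"
    proof (rule Linf_norm_leI)
      show "(\<lambda>(x, t). u x t) \<in> borel_measurable (restrict_space lborel (U' \<times> {\<epsilon><..<T}))"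
      proof (rule measurable_cylinder)
        show "continuous_on (closure U \<times> {0..}) (\<lambda>(x, t). u x t)"
          using sol unfolding nonneg_solution_def by blast
        show "U' \<times> {\<epsilon><..<T} \<subseteq> closure U \<times> {0..}"
          using U'(3) closure_subset[of U'] closure_subset[of U] \<epsilon> by auto
      qed
      have "AE z in lborel. \<forall>q\<in>F. z \<in> ball q (R / 2) \<times> {\<epsilon><..<T} \<longrightarrow> ennreal \<bar>case z of (x, t) \<Rightarrow> u x t\<bar> \<le> ennreal ?B"
        using near by (rule AE_finite_allI[OF F(2)])
      then have "AE z in lborel. z \<in> U' \<times> {\<epsilon><..<T} \<longrightarrow> ennreal \<bar>case z of (x, t) \<Rightarrow> u x t\<bar> \<le> ennreal ?B"
      proof (rule eventually_mono, intro impI)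
        fix z assume H: "\<forall>q\<in>F. z \<in> ball q (R / 2) \<times> {\<epsilon><..<T} \<longrightarrow> ennreal \<bar>case z of (x, t) \<Rightarrow> u x t\<bar> \<le> ennreal ?B"
          and z: "z \<in> U' \<times> {\<epsilon><..<T}"
        have "fst z \<in> (\<Union>q\<in>F. ball q (R / 2))" using z closure_subset[of U'] by (intro subsetD[OF F(3)]) auto
        then show "ennreal \<bar>case z of (x, t) \<Rightarrow> u x t\<bar> \<le> ennreal ?B" using H z by (cases z) auto
      qed
      then show "AE z in restrict_space lborel (U' \<times> {\<epsilon><..<T}). ennreal \<bar>case z of (x, t) \<Rightarrow> u x t\<bar> \<le> ennreal ?B"
        by (subst AE_restrict_space_iff) (use U'(1) in \<open>auto intro!: borel_open open_Times\<close>)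
    qed
  qed
qed

section \<open>Growth of the integral of a power of the solution\<close>

lemma flux_integral_mono:
  assumes "s \<le> t"
  shows "flux_integral G lam U \<phi> p s \<le> flux_integral G lam U \<phi> p t"
  unfolding flux_integral_def using assms
  by (intro nn_integral_mono) (auto simp: indicator_def)

text \<open>In terms of \<open>m = mu1 / p\<close>, \<open>calU\<close> is formally the solution of
  \<open>z' = C2 h z powr (1 + m)\<close>, where \<open>h\<close> is the integrand of the flux integral and \<open>z(0)\<close> is
  one plus the initial integral of \<open>u\<^sup>p\<close>.\<close>

lemma calU_eq:
  fixes U :: "(real^'n) set"
  assumes "m = mu1 CARD('n) (a_exp G) (1 - lam) p / p"
  shows "calU G lam U u0 \<phi> p C2 t
    = ((1 + (LINT x:U|lborel. u0 x powr p)) powr (- m) - C2 * m * enn2real (flux_integral G lam U \<phi> p t))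
      powr (- (1 / m))"
  unfolding assms by (simp add: calU_def C3_const_def Let_def)

text \<open>Dropping the gradient term from the energy inequality leaves the differential inequality of
  \<open>superlinear_gronwall\<close> for the integral of \<open>u\<^sup>p\<close>.\<close>

lemma mass_le_calU:
  fixes U :: "(real^'n) set"
  assumes sol: "nonneg_solution G lam U u0 \<phi> u" and en: "energy_constants G lam U p C1 C2"
    and U: "open U" "bounded U" and "0 < p" "0 \<le> t"
    and m: "m = mu1 CARD('n) (a_exp G) (1 - lam) p / p" "0 < m"
    and flux: "flux_integral G lam U \<phi> p t
      < ennreal (1 / (C2 * m) * (1 + (LINT x:U|lborel. u0 x powr p)) powr (- m))"
  shows "1 + (LINT x:U|lborel. u x t powr p) \<le> calU G lam U u0 \<phi> p C2 t"
proof -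
  define y where "y = (\<lambda>s. LINT x:U|lborel. u x s powr p)"
  define h where "h \<tau> = 1 + ennreal_powr (neg_part_norm U \<phi> \<tau>) (flux_power CARD('n) (a_exp G) (1 - lam) p)" for \<tau>
  define H where "H = enn2real (flux_integral G lam U \<phi> p t)"
  have C: "0 < C1" "0 < C2" using en unfolding energy_constants_def Let_def by auto
  have y0: "y 0 = (LINT x:U|lborel. u0 x powr p)"
    unfolding y_def using solution_initial[OF sol] U(1) by (intro set_lebesgue_integral_cong) auto
  have "flux_integral G lam U \<phi> p t < top" using flux by (rule less_trans) simp
  then have fin: "flux_integral G lam U \<phi> p t = ennreal H" by (simp add: H_def)
  have H: "0 \<le> H" by (simp add: H_def)
  have "H < 1 / (C2 * m) * (1 + y 0) powr (- m)"
    using flux H unfolding fin y0 by (simp add: ennreal_less_iff)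
  moreover have "0 < C2 * m" using C m(2) by simp
  ultimately have small: "C2 * m * H < (1 + y 0) powr (- m)"
    by (simp add: pos_less_divide_eq mult.commute)
  have ineq: "\<exists>D. (y has_real_derivative D) (at s) \<and>
      ennreal D \<le> ennreal C2 * h s * ennreal ((1 + y s) powr (1 + m))" if s: "0 < s" for s
  proof -
    let ?I = "LINT x:U|lborel. norm (grad (\<lambda>y. u y s) x) powr (2 - a_exp G) * u x s powr (p + (1 - lam) - 2)"
    obtain D where D: "(y has_real_derivative D) (at s)"
      "ennreal (D + C1 * ?I) \<le> ennreal C2 * h s * ennreal ((1 + y s) powr (1 + m))"
      using en[unfolded energy_constants_def Let_def, THEN conjunct2, THEN conjunct2, rule_format, OF sol s]
      unfolding y_def h_def m(1) by blast
    have "0 \<le> C1 * ?I"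
      unfolding set_lebesgue_integral_def using C
      by (intro mult_nonneg_nonneg integral_nonneg_AE) (auto simp: indicator_def)
    then have "ennreal D \<le> ennreal (D + C1 * ?I)" by (intro ennreal_leI) simp
    with D show ?thesis using order_trans by blast
  qed
  have "1 + y t \<le> ((1 + y 0) powr (- m) - C2 * m * H) powr (- (1 / m))"
  proof (rule superlinear_gronwall[where h = h])
    show "continuous_on {0..t} y"
      unfolding y_def by (rule continuous_on_slice_integral[OF U solution_powr_continuous[OF sol assms(5)]])
    show "0 \<le> y s" if "0 \<le> s" for s
      unfolding y_def set_lebesgue_integral_def by (intro integral_nonneg_AE) (auto simp: indicator_def)
    show "(\<integral>\<^sup>+ s\<in>{0..t}. h s \<partial>lborel) = ennreal H"
      using fin unfolding flux_integral_def h_def .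
  qed (use ineq small H m C assms in auto)
  then show ?thesis
    unfolding calU_eq[OF m(1)] H_def y0 by (simp add: y_def)
qed

text \<open>Up to time \<open>t\<close> the base of the power in \<open>calU_eq\<close> stays positive while it decreases, and the exponent
  is negative.\<close>

lemma calU_mono:
  fixes U :: "(real^'n) set"
  assumes m: "m = mu1 CARD('n) (a_exp G) (1 - lam) p / p" "0 < m" and "0 < C2"
    and flux: "flux_integral G lam U \<phi> p t
      < ennreal (1 / (C2 * m) * (1 + (LINT x:U|lborel. u0 x powr p)) powr (- m))"
    and "s \<le> t"
  shows "calU G lam U u0 \<phi> p C2 s \<le> calU G lam U u0 \<phi> p C2 t"
proof -
  let ?F = "\<lambda>s. enn2real (flux_integral G lam U \<phi> p s)"
  let ?A = "(1 + (LINT x:U|lborel. u0 x powr p)) powr (- m)"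
  have C3: "0 < C2 * m" by (rule mult_pos_pos[OF assms(3) m(2)])
  have top: "flux_integral G lam U \<phi> p t < top" using flux by (rule less_trans) simp
  then have "?F t < 1 / (C2 * m) * ?A"
    using flux by (simp add: enn2real_less_iff)
  then have "0 < ?A - (C2 * m) * ?F t" using C3 by (simp add: pos_less_divide_eq mult.commute)
  moreover have "?F s \<le> ?F t"
    using flux_integral_mono[OF assms(5)] top by (rule enn2real_mono)
  from mult_left_mono[OF this less_imp_le[OF C3]] have "?A - (C2 * m) * ?F t \<le> ?A - (C2 * m) * ?F s"
    by simp
  ultimately show ?thesis
    unfolding calU_eq[OF m(1)] using m(2) by (intro powr_mono2') auto
qed

text \<open>Extending \<open>f\<close> by its boundary values gives a monotone, hence Borel measurable, function on the
  whole line.\<close>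

lemma mono_on_set_integrable:
  fixes f :: "real \<Rightarrow> real"
  assumes "mono_on {a..b} f" "a \<le> b"
  shows "set_integrable lborel {a..b} f"
proof -
  let ?g = "\<lambda>t. f (max a (min b t))"
  have "mono ?g" using assms by (intro monoI mono_onD[OF assms(1)]) auto
  then have "?g \<in> borel_measurable lborel" using borel_measurable_mono by simp
  moreover have "norm (f t) \<le> \<bar>f a\<bar> + \<bar>f b\<bar>" if "t \<in> {a..b}" for t
  proof -
    have "f a \<le> f t" "f t \<le> f b"
      using that assms(2) by (auto intro!: mono_onD[OF assms(1)])
    then show ?thesis unfolding real_norm_def by linarith
  qed
  ultimately have "set_integrable lborel {a..b} ?g"
    unfolding set_integrable_def using emeasure_bounded_finite[of "{a..b}"]
    by (intro integrableI_bounded_set_indicator[where B = "\<bar>f a\<bar> + \<bar>f b\<bar>"] AE_I2 impI) auto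
  moreover have "set_integrable lborel {a..b} ?g \<longleftrightarrow> set_integrable lborel {a..b} f"
    by (intro set_integrable_cong) auto
  ultimately show ?thesis by blast
qed

text \<open>Integrating the pointwise bound in time.  As \<open>calU\<close> is non-decreasing up to \<open>T\<close>, it is integrable
  and at most its final value.\<close>

lemma cylinder_mass_le_calU:
  fixes U :: "(real^'n) set"
  assumes sol: "nonneg_solution G lam U u0 \<phi> u" and en: "energy_constants G lam U p C1 C2"
    and U: "open U" "bounded U" and "0 < p" "0 \<le> T"
    and m: "m = mu1 CARD('n) (a_exp G) (1 - lam) p / p" "0 < m"
    and flux: "flux_integral G lam U \<phi> p T
      < ennreal (1 / (C2 * m) * (1 + (LINT x:U|lborel. u0 x powr p)) powr (- m))"
  shows "(LINT t:{0..T}|lborel. LINT x:U|lborel. u x t powr p) \<le> (LINT t:{0..T}|lborel. calU G lam U u0 \<phi> p C2 t)"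
    and "(LINT t:{0..T}|lborel. calU G lam U u0 \<phi> p C2 t) \<le> T * calU G lam U u0 \<phi> p C2 T"
proof -
  have C2: "0 < C2" using en unfolding energy_constants_def Let_def by auto
  have flux': "flux_integral G lam U \<phi> p t
      < ennreal (1 / (C2 * m) * (1 + (LINT x:U|lborel. u0 x powr p)) powr (- m))" if "t \<le> T" for t
    using flux_integral_mono[OF that] flux by (rule le_less_trans)
  have mono: "calU G lam U u0 \<phi> p C2 s \<le> calU G lam U u0 \<phi> p C2 t" if "s \<le> t" "t \<le> T" for s t
    using calU_mono[OF m C2 flux'[OF that(2)] that(1)] .
  have int: "set_integrable lborel {0..T} (calU G lam U u0 \<phi> p C2)"
    by (rule mono_on_set_integrable) (use mono assms in \<open>auto intro!: mono_onI\<close>)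
  have "set_integrable lborel {0..T} (\<lambda>t. LINT x:U|lborel. u x t powr p)"
    by (rule continuous_set_integrable_bounded[of _ "{0..T}"])
       (auto intro!: continuous_on_slice_integral[OF U solution_powr_continuous[OF sol assms(5)]])
  then show "(LINT t:{0..T}|lborel. LINT x:U|lborel. u x t powr p) \<le> (LINT t:{0..T}|lborel. calU G lam U u0 \<phi> p C2 t)"
  proof (rule set_integral_mono[OF _ int])
    show "(LINT x:U|lborel. u x t powr p) \<le> calU G lam U u0 \<phi> p C2 t" if "t \<in> {0..T}" for t
      using mass_le_calU[OF sol en U assms(5) _ m flux', of t] that by auto
  qed
  have "(LINT t:{0..T}|lborel. calU G lam U u0 \<phi> p C2 t) \<le> (LINT t:{0..T}|lborel. calU G lam U u0 \<phi> p C2 T)"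
    using mono by (intro set_integral_mono int continuous_set_integrable_bounded[of _ "{0..T}"]) auto
  also have "\<dots> = T * calU G lam U u0 \<phi> p C2 T"
    using assms(6) by (simp add: set_lebesgue_integral_def)
  finally show "(LINT t:{0..T}|lborel. calU G lam U u0 \<phi> p C2 t) \<le> T * calU G lam U u0 \<phi> p C2 T" .
qed

text \<open>The bound on the flux integral leaves at least the fraction \<open>2 powr (- m)\<close> of the initial value of
  the base in \<open>calU_eq\<close>, and \<open>(2 powr (- m)) powr (- (1 / m)) = 2\<close>.\<close>

lemma calU_le_double:
  fixes U :: "(real^'n) set"
  assumes m: "m = mu1 CARD('n) (a_exp G) (1 - lam) p / p" "0 < m" and "0 < C2"
    and I0: "0 \<le> (LINT x:U|lborel. u0 x powr p)"
    and flux: "flux_integral G lam U \<phi> p t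
      \<le> ennreal ((1 - 2 powr (- m)) / (C2 * m) * (1 + (LINT x:U|lborel. u0 x powr p)) powr (- m))"
  shows "calU G lam U u0 \<phi> p C2 t \<le> 2 * (1 + (LINT x:U|lborel. u0 x powr p))"
proof -
  let ?I0 = "LINT x:U|lborel. u0 x powr p"
  let ?F = "enn2real (flux_integral G lam U \<phi> p t)"
  let ?A = "(1 + ?I0) powr (- m)"
  have C3: "0 < C2 * m" by (rule mult_pos_pos[OF assms(3) m(2)])
  have lt1: "2 powr (- m) < (1::real)" using m by (simp add: powr_less_one)
  have "?F \<le> (1 - 2 powr (- m)) / (C2 * m) * ?A"
    using flux lt1 C3 by (intro enn2real_leI) auto
  then have "(C2 * m) * ?F \<le> (1 - 2 powr (- m)) * ?A"
    using C3 by (simp add: pos_le_divide_eq mult.commute)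
  then have le: "2 powr (- m) * ?A \<le> ?A - (C2 * m) * ?F" by (simp add: algebra_simps)
  have "calU G lam U u0 \<phi> p C2 t = (?A - (C2 * m) * ?F) powr (- (1 / m))"
    by (rule calU_eq[OF m(1)])
  also have "\<dots> \<le> (2 powr (- m) * ?A) powr (- (1 / m))"
    using le m(2) I0 by (intro powr_mono2') auto
  also have "\<dots> = ((2 * (1 + ?I0)) powr (- m)) powr (- (1 / m))"
    using I0 by (simp add: powr_mult del: distrib_left_numeral)
  also have "\<dots> = 2 * (1 + ?I0)"
    using I0 m(2) unfolding powr_powr by simp
  finally show ?thesis .
qed

section \<open>The bound in terms of the initial data\<close>

lemma flux_threshold_less:
  assumes "0 < m" "0 < c" "0 < (A::real)"
  shows "ennreal ((1 - 2 powr (- m)) / c * A) < ennreal (1 / c * A)"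
proof -
  have "(1 - 2 powr (- m)) / c * A < 1 / c * A"
    using assms by (intro mult_strict_right_mono divide_strict_right_mono) auto
  then show ?thesis using assms by (intro ennreal_lessI) auto
qed

text \<open>With \<open>s = I powr (1 / p)\<close> this is \<open>1 + s powr p \<le> (1 + s) powr p\<close>, which follows from
  \<open>(1 + s) powr p = (1 + s) powr (p - 1) + s (1 + s) powr (p - 1)\<close>.\<close>

lemma one_plus_powr_le:
  fixes I p :: real
  assumes "1 \<le> p" "0 \<le> I"
  shows "(1 + I) powr (1 / p) \<le> 1 + I powr (1 / p)"
proof -
  let ?s = "I powr (1 / p)"
  have "1 + ?s * ?s powr (p - 1) \<le> (1 + ?s) powr (p - 1) + ?s * (1 + ?s) powr (p - 1)"
    using assms by (intro add_mono mult_left_mono powr_mono2 ge_one_powr_ge_zero) auto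
  also have "\<dots> = (1 + ?s) * (1 + ?s) powr (p - 1)" by (simp add: algebra_simps)
  also have "\<dots> = (1 + ?s) powr p" by (simp add: powr_mult_base add_nonneg_nonneg)
  also have "?s * ?s powr (p - 1) = ?s powr (1 + (p - 1))" by (rule powr_mult_base) simp
  also have "\<dots> = I" using assms by (simp add: powr_powr)
  finally have "(1 + I) powr (1 / p) \<le> ((1 + ?s) powr p) powr (1 / p)"
    using assms by (intro powr_mono2) auto
  also have "\<dots> = 1 + ?s" using assms by (simp add: powr_powr add_nonneg_nonneg)
  finally show ?thesis .
qed

text \<open>The majorant \<open>2 (1 + T) (1 + I)\<close> of \<open>Z\<close> is at least \<open>1\<close>, so its larger power dominates.\<close>

lemma max_powr_le_initial:
  fixes Z T I p \<mu> \<nu> :: real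
  assumes "0 \<le> Z" "Z \<le> T * (2 * (1 + I))" "0 \<le> T" "0 \<le> I" "1 \<le> p" "0 \<le> \<mu>" "\<mu> \<le> \<nu>"
  shows "max (Z powr (\<mu> / p)) (Z powr (\<nu> / p)) \<le> 2 powr (\<nu> / p) * (1 + T) powr (\<nu> / p) * (1 + I powr (1 / p)) powr \<nu>"
proof -
  let ?W = "2 * (1 + T) * (1 + I)"
  have "1 * 1 \<le> (1 + T) * (1 + I)" using assms by (intro mult_mono) auto
  then have "1 \<le> 2 * ((1 + T) * (1 + I))" by linarith
  then have W: "1 \<le> ?W" by (simp only: mult.assoc)
  have ZW: "Z \<le> ?W" using assms by (simp add: algebra_simps)
  have "Z powr (\<mu> / p) \<le> ?W powr (\<mu> / p)" "Z powr (\<nu> / p) \<le> ?W powr (\<nu> / p)"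
    using assms ZW by (auto intro!: powr_mono2)
  moreover have "?W powr (\<mu> / p) \<le> ?W powr (\<nu> / p)"
    using W assms by (intro powr_mono divide_right_mono) auto
  ultimately have "max (Z powr (\<mu> / p)) (Z powr (\<nu> / p)) \<le> ?W powr (\<nu> / p)" by simp
  also have "\<dots> = 2 powr (\<nu> / p) * (1 + T) powr (\<nu> / p) * ((1 + I) powr (1 / p)) powr \<nu>"
    using assms by (simp add: powr_mult powr_powr del: distrib_left_numeral)
  also have "\<dots> \<le> 2 powr (\<nu> / p) * (1 + T) powr (\<nu> / p) * (1 + I powr (1 / p)) powr \<nu>"
    using one_plus_powr_le[OF assms(5,4)] assms by (intro mult_left_mono powr_mono2) auto
  finally show ?thesis .
qed

section \<open>The supremum estimate\<close>

theorem theorem5p5: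
  fixes G :: forchheimer and U U' :: "(real^'n) set"
    and n :: nat and a lam \<delta> \<alpha>0 \<omega> \<mu> \<nu> :: real
  assumes "n = CARD('n)" and "2 \<le> n"
    and "C1_domain U"
    and "forchheimer_law G" and "a = a_exp G"
    and "0 < lam" and "lam \<le> 1" and "\<delta> = 1 - lam" and "\<delta> < a"
    and "open U'" and "compact (closure U')" and "closure U' \<subseteq> U"
    and "2 - \<delta> \<le> \<alpha>0" and "alpha_star n a \<delta> < \<alpha>0"
    and "\<mu> = mu_exp n a \<delta> \<alpha>0" and "\<nu> = nu_exp n a \<delta> \<alpha>0"
    and "0 < \<omega>"
    and "\<exists>c10\<ge>1. \<forall>V :: (real^'n) set. C1_domain V \<longrightarrow> interior_estimate G lam V \<alpha>0 \<omega> c10"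
  shows "\<exists>C>0. \<forall>u0 \<phi> u. nonneg_solution G lam U u0 \<phi> u \<longrightarrow>
    (\<forall>T \<epsilon>. 0 < T \<and> 0 < \<epsilon> \<and> \<epsilon> < min 1 T \<longrightarrow>
      Linf_norm (restrict_space lborel (U' \<times> {\<epsilon><..<T})) (\<lambda>(x, t). u x t)
      \<le> ennreal (C * \<epsilon> powr (- 2 * \<omega>) * (1 + T) powr (3 * \<omega>) *
          max (Lp_norm \<alpha>0 (U \<times> {0<..<T}) (\<lambda>(x, t). u x t) powr \<mu>)
              (Lp_norm \<alpha>0 (U \<times> {0<..<T}) (\<lambda>(x, t). u x t) powr \<nu>))) \<and>
    (real n * mu0 a \<delta> < \<alpha>0 \<longrightarrow>
     (\<forall>C1 C2. energy_constants G lam U \<alpha>0 C1 C2 \<longrightarrow>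
      (\<forall>T \<epsilon>. 0 < T \<and> 0 < \<epsilon> \<and> \<epsilon> < min 1 T \<longrightarrow>
        (flux_integral G lam U \<phi> \<alpha>0 T
           < ennreal (1 / C3_const n a \<delta> \<alpha>0 C2 *
               (1 + (LINT x:U|lborel. u0 x powr \<alpha>0)) powr (- (mu1 n a \<delta> \<alpha>0 / \<alpha>0))) \<longrightarrow>
         Linf_norm (restrict_space lborel (U' \<times> {\<epsilon><..<T})) (\<lambda>(x, t). u x t)
         \<le> ennreal (C * \<epsilon> powr (- 2 * \<omega>) * (1 + T) powr (3 * \<omega>) *
             max ((LINT t:{0..T}|lborel. calU G lam U u0 \<phi> \<alpha>0 C2 t) powr (\<mu> / \<alpha>0))
                 ((LINT t:{0..T}|lborel. calU G lam U u0 \<phi> \<alpha>0 C2 t) powr (\<nu> / \<alpha>0)))) \<and>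
        (flux_integral G lam U \<phi> \<alpha>0 T
           \<le> ennreal ((1 - 2 powr (- (mu1 n a \<delta> \<alpha>0 / \<alpha>0))) / C3_const n a \<delta> \<alpha>0 C2 *
               (1 + (LINT x:U|lborel. u0 x powr \<alpha>0)) powr (- (mu1 n a \<delta> \<alpha>0 / \<alpha>0))) \<longrightarrow>
         Linf_norm (restrict_space lborel (U' \<times> {\<epsilon><..<T})) (\<lambda>(x, t). u x t)
         \<le> ennreal (C * \<epsilon> powr (- 2 * \<omega>) * (1 + T) powr (3 * \<omega> + \<nu> / \<alpha>0) *
             (1 + Lp_norm \<alpha>0 U u0) powr \<nu>)))))"
proof -
  have n: "0 < n" and a1: "a < 1" and om: "0 \<le> \<omega>"
    using assms(2,17) a_exp_less_1[OF assms(4)] assms(5) by auto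
  note exps = sup_estimate_exponents[OF n a1 assms(9,13,14), folded assms(15,16)]
  have p: "1 \<le> \<alpha>0" using assms(6,8,13) by simp
  have U: "open U" "bounded U" using assms(3) by (auto simp: C1_domain_def)
  note cardn = assms(1)[symmetric] and aexp = assms(5)[symmetric] and delta = assms(8)[symmetric]
  obtain c10 where c10: "1 \<le> c10" "interior_estimate G lam U \<alpha>0 \<omega> c10"
    using assms(18,3) by blast
  obtain C where C: "0 < C" and est:
    "\<And>u0 \<phi> u T \<epsilon>. nonneg_solution G lam U u0 \<phi> u \<Longrightarrow> 0 < T \<Longrightarrow> 0 < \<epsilon> \<Longrightarrow> \<epsilon> < min 1 T \<Longrightarrow>
      Linf_norm (restrict_space lborel (U' \<times> {\<epsilon><..<T})) (\<lambda>(x, t). u x t)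
      \<le> ennreal (C * \<epsilon> powr (- 2 * \<omega>) * (1 + T) powr (3 * \<omega>) *
          max (Lp_norm \<alpha>0 (U \<times> {0<..<T}) (\<lambda>(x, t). u x t) powr \<mu>)
              (Lp_norm \<alpha>0 (U \<times> {0<..<T}) (\<lambda>(x, t). u x t) powr \<nu>))"
  proof (rule interior_sup_estimate[OF c10(2,1) U assms(10-12) _ om, unfolded cardn aexp delta, folded assms(15,16)])
    show "0 < \<alpha>0" using p by simp
    show "0 \<le> \<mu>" "0 \<le> \<nu>" using exps by auto
  qed blast
  have two: "1 \<le> 2 powr (\<nu> / \<alpha>0)" using exps p by (intro ge_one_powr_ge_zero) auto
  \<comment> \<open>The first factor absorbs the \<open>2\<close> of \<open>calU_le_double\<close>, raised to the power \<open>\<nu> / \<alpha>0\<close>; it is at least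
    \<open>1\<close>, so \<open>K\<close> serves for all three assertions.\<close>
  define K where "K = 2 powr (\<nu> / \<alpha>0) * C"
  have K: "0 < K" "C \<le> K" using C two unfolding K_def by auto
  show ?thesis
  proof (intro exI[of _ K] conjI allI impI)
    show "0 < K" by (rule K(1))
    fix u0 \<phi> u and T \<epsilon> :: real
    assume sol: "nonneg_solution G lam U u0 \<phi> u" and T\<epsilon>: "0 < T \<and> 0 < \<epsilon> \<and> \<epsilon> < min 1 T"
    let ?E = "\<epsilon> powr (- 2 * \<omega>) * (1 + T) powr (3 * \<omega>)"
    let ?u = "Linf_norm (restrict_space lborel (U' \<times> {\<epsilon><..<T})) (\<lambda>(x, t). u x t)"
    let ?L = "Lp_norm \<alpha>0 (U \<times> {0<..<T}) (\<lambda>(x, t). u x t)"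
    have L: "?u \<le> ennreal (C * ?E * max (?L powr \<mu>) (?L powr \<nu>))"
      using est[OF sol, of T \<epsilon>] T\<epsilon> by (simp add: mult.assoc)
    also have "\<dots> \<le> ennreal (K * ?E * max (?L powr \<mu>) (?L powr \<nu>))"
      using K(2) by (intro ennreal_leI mult_right_mono) (auto simp: le_max_iff_disj)
    finally show "?u \<le> ennreal (K * \<epsilon> powr (- 2 * \<omega>) * (1 + T) powr (3 * \<omega>) * max (?L powr \<mu>) (?L powr \<nu>))"
      by (simp add: mult.assoc)
    fix C1 C2
    assume big: "real n * mu0 a \<delta> < \<alpha>0" and en: "energy_constants G lam U \<alpha>0 C1 C2"
    define m where "m = mu1 n a \<delta> \<alpha>0 / \<alpha>0"
    have m: "m = mu1 CARD('n) (a_exp G) (1 - lam) \<alpha>0 / \<alpha>0" "0 < m"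
      using mu1_pos[OF n a1 assms(9) big] p by (auto simp: m_def assms(1,5,8))
    have C2: "0 < C2" using en unfolding energy_constants_def Let_def by auto
    have C3: "C3_const n a \<delta> \<alpha>0 C2 = C2 * m" by (simp add: C3_const_def m_def)
    let ?I0 = "LINT x:U|lborel. u0 x powr \<alpha>0"
    let ?Y = "LINT t:{0..T}|lborel. LINT x:U|lborel. u x t powr \<alpha>0"
    let ?Z = "LINT t:{0..T}|lborel. calU G lam U u0 \<phi> \<alpha>0 C2 t"
    have I0: "0 \<le> ?I0"
      unfolding set_lebesgue_integral_def by (intro integral_nonneg_AE) (auto simp: indicator_def)
    have Y: "0 \<le> ?Y"
      unfolding set_lebesgue_integral_def by (intro integral_nonneg_AE AE_I2 scaleR_nonneg_nonneg) (auto simp: indicator_def)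
    have Lpow: "?L powr q = ?Y powr (q / \<alpha>0)" for q
      using p by (subst Lp_norm_cylinder[OF sol U]) (auto simp: powr_powr)
    have second: "?u \<le> ennreal (C * ?E * max (?Z powr (\<mu> / \<alpha>0)) (?Z powr (\<nu> / \<alpha>0)))"
      and Z: "0 \<le> ?Z" "?Z \<le> T * calU G lam U u0 \<phi> \<alpha>0 C2 T"
      if flux: "flux_integral G lam U \<phi> \<alpha>0 T < ennreal (1 / (C2 * m) * (1 + ?I0) powr (- m))"
    proof -
      have YZ: "?Y \<le> ?Z" "?Z \<le> T * calU G lam U u0 \<phi> \<alpha>0 C2 T"
        using cylinder_mass_le_calU[OF sol en U _ _ m flux] p T\<epsilon> by auto
      show "0 \<le> ?Z" "?Z \<le> T * calU G lam U u0 \<phi> \<alpha>0 C2 T" using Y YZ by auto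
      have "max (?L powr \<mu>) (?L powr \<nu>) \<le> max (?Z powr (\<mu> / \<alpha>0)) (?Z powr (\<nu> / \<alpha>0))"
        unfolding Lpow using Y YZ(1) exps p by (intro max_powr_mono) auto
      then have "ennreal (C * ?E * max (?L powr \<mu>) (?L powr \<nu>))
          \<le> ennreal (C * ?E * max (?Z powr (\<mu> / \<alpha>0)) (?Z powr (\<nu> / \<alpha>0)))"
        using C by (intro ennreal_leI mult_left_mono) auto
      with L show "?u \<le> ennreal (C * ?E * max (?Z powr (\<mu> / \<alpha>0)) (?Z powr (\<nu> / \<alpha>0)))"
        by (rule order_trans)
    qed
    { assume "flux_integral G lam U \<phi> \<alpha>0 T
           < ennreal (1 / C3_const n a \<delta> \<alpha>0 C2 * (1 + ?I0) powr (- (mu1 n a \<delta> \<alpha>0 / \<alpha>0)))"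
      from second[OF this[unfolded C3, folded m_def]]
      have "?u \<le> ennreal (C * ?E * max (?Z powr (\<mu> / \<alpha>0)) (?Z powr (\<nu> / \<alpha>0)))" .
      also have "\<dots> \<le> ennreal (K * ?E * max (?Z powr (\<mu> / \<alpha>0)) (?Z powr (\<nu> / \<alpha>0)))"
        using K(2) by (intro ennreal_leI mult_right_mono) (auto simp: le_max_iff_disj)
      finally show "?u \<le> ennreal (K * \<epsilon> powr (- 2 * \<omega>) * (1 + T) powr (3 * \<omega>)
          * max (?Z powr (\<mu> / \<alpha>0)) (?Z powr (\<nu> / \<alpha>0)))"
        by (simp add: mult.assoc) }
    assume "flux_integral G lam U \<phi> \<alpha>0 T
       \<le> ennreal ((1 - 2 powr (- (mu1 n a \<delta> \<alpha>0 / \<alpha>0))) / C3_const n a \<delta> \<alpha>0 C2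
           * (1 + ?I0) powr (- (mu1 n a \<delta> \<alpha>0 / \<alpha>0)))"
    then have flux: "flux_integral G lam U \<phi> \<alpha>0 T
        \<le> ennreal ((1 - 2 powr (- m)) / (C2 * m) * (1 + ?I0) powr (- m))"
      unfolding C3 m_def .
    also have "\<dots> < ennreal (1 / (C2 * m) * (1 + ?I0) powr (- m))"
      using m(2) C2 I0 by (intro flux_threshold_less) auto
    finally have flux': "flux_integral G lam U \<phi> \<alpha>0 T < ennreal (1 / (C2 * m) * (1 + ?I0) powr (- m))" .
    have "?Z \<le> T * (2 * (1 + ?I0))"
      using Z(2)[OF flux'] mult_left_mono[OF calU_le_double[OF m C2 I0 flux], of T] T\<epsilon> by linarith
    then have Zle: "max (?Z powr (\<mu> / \<alpha>0)) (?Z powr (\<nu> / \<alpha>0))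
        \<le> 2 powr (\<nu> / \<alpha>0) * (1 + T) powr (\<nu> / \<alpha>0) * (1 + ?I0 powr (1 / \<alpha>0)) powr \<nu>"
      using Z(1)[OF flux'] T\<epsilon> I0 p exps by (intro max_powr_le_initial) auto
    have "Lp_norm \<alpha>0 U u0 = ?I0 powr (1 / \<alpha>0)"
    proof -
      have "(LINT x:U|lborel. \<bar>u0 x\<bar> powr \<alpha>0) = ?I0"
        using solution_nonneg[OF sol, of _ 0] solution_initial[OF sol] U(1)
        by (intro set_lebesgue_integral_cong) auto
      then show ?thesis by (simp add: Lp_norm_def)
    qed
    with Zle have "C * ?E * max (?Z powr (\<mu> / \<alpha>0)) (?Z powr (\<nu> / \<alpha>0))
        \<le> C * ?E * (2 powr (\<nu> / \<alpha>0) * (1 + T) powr (\<nu> / \<alpha>0) * (1 + Lp_norm \<alpha>0 U u0) powr \<nu>)"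
      using C by (intro mult_left_mono) auto
    also have "\<dots> = K * \<epsilon> powr (- 2 * \<omega>) * (1 + T) powr (3 * \<omega> + \<nu> / \<alpha>0) * (1 + Lp_norm \<alpha>0 U u0) powr \<nu>"
      unfolding K_def powr_add by (simp only: ac_simps)
    finally show "?u \<le> ennreal (K * \<epsilon> powr (- 2 * \<omega>) * (1 + T) powr (3 * \<omega> + \<nu> / \<alpha>0) * (1 + Lp_norm \<alpha>0 U u0) powr \<nu>)"
      using second[OF flux'] by (blast intro: order_trans ennreal_leI)
  qed
qed

end
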